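(* Let $(\mathcal Q,d)$ be a metric space, $\mathcal Y$ a (measurable) set, and $\mathfrak c\colon \mathcal Y\times\mathcal Q\to\mathbb R$ a function. Let $Y$ be a random variable with values in $\mathcal Y$, let $Y_1,Y_2,\dots$ be independent random variables with the same distribution as $Y$, and let $(\epsilon_n)_{n\in\mathbb N}\subseteq[0,\infty)$ with $\epsilon_n\to 0$ as $n\to\infty$. Set $$M=\operatorname*{arg\,min}_{q\in\mathcal Q}\mathbb E[\mathfrak c(Y,q)],\qquad M_n=\epsilon_n\text{-}\operatorname*{arg\,min}_{q\in\mathcal Q}\frac1n\sum_{i=1}^n\mathfrak c(Y_i,q).$$ Assume: (1) $(\mathcal Q,d)$ is separable and complete; (2) for every $y\in\mathcal Y$, the function $q\mapsto\mathfrak c(y,q)$ is lower semi-continuous; (3) $\mathbb E[|\mathfrak c(Y,q)|]<\infty$ for all $q\in\mathcal Q$; (4) $\mathbb E[\inf_{q\in\mathcal Q}\mathfrak c(Y,q)]>-\infty$. Then, almost surely, $$\operatorname*{lim\,\overline{sup}}_{n\to\infty} M_n\subseteq M.$$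
   Context: All random variables are defined on a common probability space $(\Omega,\Sigma,\mathbb P)$. For $f\colon\mathcal Q\to\mathbb R$ and $\epsilon\ge0$: $\operatorname{arg\,min} f=\{q\in\mathcal Q: f(q)=\inf_{\mathcal Q} f\}$ and $\epsilon\text{-}\operatorname{arg\,min} f=\{q\in\mathcal Q: f(q)\le\epsilon+\inf_{\mathcal Q} f\}$. The outer limit of a sequence of sets $B_n\subseteq\mathcal Q$ is $\operatorname*{lim\,\overline{sup}}_{n\to\infty}B_n:=\bigcap_{n\in\mathbb N}\overline{\bigcup_{k\ge n}B_k}$, where the bar denotes topological closure in $\mathcal Q$. $f$ is lower semi-continuous if $\liminf_{x\to x_0}f(x)\ge f(x_0)$ for all $x_0\in\mathcal Q$. Measurability convention: all spaces carry the necessary measurable structure and all functions are measurable whenever necessary. In particular, $\mathcal Y$ carries a $\sigma$-algebra, $\mathcal Q$ its Borel $\sigma$-algebra, $\mathfrak c$ is jointly measurable, and expectations and almost sure statements are understood with respect to the completion of the probability space. *)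

theory Defs
  imports "HOL-Probability.Probability"
begin

(* Infima are taken in ereal: the infimum of a real-valued function that is unbounded below
   is then -\<infinity> (in which case both sets below are empty), while the conditionally
   complete Inf on real would return an unspecified value. *)
definition argmin_set :: "('q \<Rightarrow> real) \<Rightarrow> 'q set" where
  "argmin_set f = {q. ereal (f q) = (INF q'. ereal (f q'))}"

definition eps_argmin_set :: "real \<Rightarrow> ('q \<Rightarrow> real) \<Rightarrow> 'q set" where
  "eps_argmin_set \<epsilon> f = {q. ereal (f q) \<le> ereal \<epsilon> + (INF q'. ereal (f q'))}"

definition outer_limit :: "(nat \<Rightarrow> 'q::topological_space set) \<Rightarrow> 'q set" where
  "outer_limit B = (\<Inter>n. closure (\<Union>k\<in>{n..}. B k))"

(* The filter "at x0" is punctured; at an isolated point it is trivial, the Liminf is \<infinity>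
   and the condition is vacuous. *)
definition lower_semicont :: "('q::topological_space \<Rightarrow> real) \<Rightarrow> bool" where
  "lower_semicont f \<longleftrightarrow> (\<forall>x0. ereal (f x0) \<le> Liminf (at x0) (\<lambda>x. ereal (f x)))"

(* Expectation of an extended-real function as the difference of the integrals of its
   positive and negative parts (e2ennreal sends negative values to 0).  The conventional
   value of \<infinity> - \<infinity> is not meaningful: use only when one of the two parts has finite integral. *)
definition ereal_expectation :: "'w measure \<Rightarrow> ('w \<Rightarrow> ereal) \<Rightarrow> ereal" where
  "ereal_expectation M X =
     enn2ereal (\<integral>\<^sup>+ w. e2ennreal (X w) \<partial>M) - enn2ereal (\<integral>\<^sup>+ w. e2ennreal (- X w) \<partial>M)"

end

theory Submission
  imports Defs
begin

text \<open>
  Write \<open>F q = E c(Y, q)\<close> and \<open>F\<^sub>n\<close> for the empirical means. If \<open>x\<close> does not minimise \<open>F\<close>, there is a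
  \<open>p\<close> with \<open>F p < F x\<close>. The infima of \<open>c y\<close> over balls shrinking to \<open>x\<close> increase to \<open>c y x\<close> by lower
  semicontinuity, and they are squeezed between the integrable function \<open>inf c y\<close> and \<open>c y x\<close>; by
  dominated convergence some ball \<open>U\<close> carries a function \<open>G \<le> c \<cdot> q\<close>, for all \<open>q \<in> U\<close>, with
  \<open>E G(Y) > F p\<close> (\<open>ball_minorant_with_large_integral\<close>). The strong law, applied to \<open>G\<close> and to
  \<open>c \<cdot> p\<close>, shows that almost surely \<open>F\<^sub>n \<ge> F\<^sub>n p + \<epsilon>\<^sub>n + \<delta>\<close> on \<open>U\<close> for large \<open>n\<close> and some \<open>\<delta> > 0\<close>, so
  that \<open>U\<close> contains no \<open>\<epsilon>\<^sub>n\<close>-minimiser and misses the outer limit. Shrinking \<open>U\<close> to a member of a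
  countable base leaves only countably many exceptional null sets.

  Two ingredients are of independent interest.

  The infimum of \<open>c y\<close> over uncountably many \<open>q\<close> is in general measurable only with respect to the
  completion, and this rests on the measurable projection theorem (\<open>measurable_projection\<close>): a measurable subset
  of \<open>M \<times> Q\<close> with \<open>Q\<close> Polish has a projection in the completion of \<open>M\<close>. Every such set
  arises by the Souslin operation from rectangles with closed second factor. Bounding the branches of
  the scheme coordinate by coordinate, while losing arbitrarily little outer measure, leaves a finitely
  branching scheme; by Koenig's lemma and completeness of \<open>Q\<close> its projection is a countable
  intersection of measurable sets, so it is a measurable inner approximation of the projection.

  The strong law (\<open>strong_law_of_large_numbers\<close>) is derived from the maximal inequality for the
  minimum of the partial sums and from Kolmogorov's zero-one law: if the partial sums become negative
  almost surely, the mean is at most zero.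
\<close>

section \<open>The Souslin operation\<close>

text \<open>
  The coordinates \<open>\<alpha> 0, \<dots>, \<alpha> n\<close> determine the value at stage \<open>n\<close>. This renders families indexed by
  finite sequences without a type of such sequences.
\<close>
definition nonanticipating :: "(nat \<Rightarrow> (nat \<Rightarrow> nat) \<Rightarrow> 'a) \<Rightarrow> bool" where
  "nonanticipating R \<longleftrightarrow> (\<forall>n \<alpha> \<beta>. (\<forall>i\<le>n. \<alpha> i = \<beta> i) \<longrightarrow> R n \<alpha> = R n \<beta>)"

text \<open>
  The family of results of the Souslin operation on members of \<open>\<E>\<close>.
\<close>
definition souslin :: "'a set set \<Rightarrow> 'a set set" where
  "souslin \<E> = {(\<Union>\<alpha>. \<Inter>n. R n \<alpha>) | R. nonanticipating R \<and> (\<forall>n \<alpha>. R n \<alpha> \<in> \<E>)}"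

lemma nonanticipatingD:
  "nonanticipating R \<Longrightarrow> (\<And>i. i \<le> n \<Longrightarrow> \<alpha> i = \<beta> i) \<Longrightarrow> R n \<alpha> = R n \<beta>"
  by (simp add: nonanticipating_def)

lemma souslin_basic: "A \<in> \<E> \<Longrightarrow> A \<in> souslin \<E>"
  unfolding souslin_def by (auto simp: nonanticipating_def intro!: exI[of _ "\<lambda>n \<alpha>. A"])

lemma souslinE:
  fixes A :: "'i \<Rightarrow> 'a set"
  assumes "\<And>j. A j \<in> souslin \<E>"
  obtains R where "\<And>j. nonanticipating (R j)" "\<And>j n \<alpha>. R j n \<alpha> \<in> \<E>"
    "\<And>j. A j = (\<Union>\<alpha>. \<Inter>n. R j n \<alpha>)"
proof -
  define P where "P j R \<longleftrightarrow> nonanticipating R \<and> (\<forall>n \<alpha>. R n \<alpha> \<in> \<E>) \<and> A j = (\<Union>\<alpha>. \<Inter>n. R n \<alpha>)" for j R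
  have "\<exists>R. P j R" for j
    using assms[of j] by (auto simp: souslin_def P_def)
  then have "\<exists>R. \<forall>j. P j (R j)" by (intro choice allI)
  then obtain R where "\<And>j. P j (R j)" by blast
  then show thesis by (intro that[of R]) (auto simp: P_def)
qed

text \<open>
  The first coordinate of a branch chooses the member of the union, the remaining ones form a branch of
  the scheme of that member. Stage \<open>n\<close> of that scheme then becomes stage \<open>n + 1\<close>, and stage \<open>0\<close> is
  filled by the largest set \<open>\<Omega>\<close>.
\<close>
lemma souslin_UN:
  fixes A :: "nat \<Rightarrow> 'a set"
  assumes A: "\<And>j. A j \<in> souslin \<E>" and top: "\<Omega> \<in> \<E>" "\<And>E. E \<in> \<E> \<Longrightarrow> E \<subseteq> \<Omega>"
  shows "(\<Union>j. A j) \<in> souslin \<E>"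
proof -
  obtain R where na: "\<And>j. nonanticipating (R j)" and R: "\<And>j n \<alpha>. R j n \<alpha> \<in> \<E>"
    and AR: "\<And>j. A j = (\<Union>\<alpha>. \<Inter>n. R j n \<alpha>)"
    by (rule souslinE[of A, OF A], rule that)
  define R' where "R' n \<alpha> = (case n of 0 \<Rightarrow> \<Omega> | Suc m \<Rightarrow> R (\<alpha> 0) m (\<lambda>i. \<alpha> (Suc i)))" for n \<alpha>
  have "nonanticipating R'"
    unfolding nonanticipating_def
  proof (intro allI impI)
    fix n and \<alpha> \<beta> :: "nat \<Rightarrow> nat" assume eq: "\<forall>i\<le>n. \<alpha> i = \<beta> i"
    show "R' n \<alpha> = R' n \<beta>"
    proof (cases n)
      case (Suc m)
      have "R (\<beta> 0) m (\<lambda>i. \<alpha> (Suc i)) = R (\<beta> 0) m (\<lambda>i. \<beta> (Suc i))"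
        by (rule nonanticipatingD[OF na]) (use eq Suc in simp)
      then show ?thesis using eq Suc by (simp add: R'_def)
    qed (simp add: R'_def)
  qed
  moreover have "R' n \<alpha> \<in> \<E>" for n \<alpha>
    by (auto simp: R'_def top R split: nat.split)
  moreover have "(\<Union>j. A j) = (\<Union>\<alpha>. \<Inter>n. R' n \<alpha>)"
  proof (intro equalityI subsetI)
    fix x assume "x \<in> (\<Union>j. A j)"
    then obtain j \<alpha> where x: "\<And>n. x \<in> R j n \<alpha>" by (auto simp: AR)
    then have "x \<in> R' n (case_nat j \<alpha>)" for n
      using subsetD[OF top(2)[OF R] x] x by (cases n) (simp_all add: R'_def)
    then show "x \<in> (\<Union>\<alpha>. \<Inter>n. R' n \<alpha>)"
      by (intro UN_I[of "case_nat j \<alpha>"] INT_I) simp_all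
  next
    fix x assume "x \<in> (\<Union>\<alpha>. \<Inter>n. R' n \<alpha>)"
    then obtain \<alpha> where "\<And>n. x \<in> R' n \<alpha>" by blast
    from this[of "Suc n" for n] have "x \<in> R (\<alpha> 0) n (\<lambda>i. \<alpha> (Suc i))" for n
      by (simp add: R'_def)
    then show "x \<in> (\<Union>j. A j)" by (auto simp: AR)
  qed
  ultimately show ?thesis unfolding souslin_def by blast
qed

lemma mono_prod_encode_snd: "i \<le> n \<Longrightarrow> prod_encode (j, i) \<le> prod_encode (j, n)"
  unfolding prod_encode_def triangle_def
  by (simp only: split add_le_mono div_le_mono mult_le_mono Suc_le_mono add_left_mono)

text \<open>
  One branch codes countably many branches through the pairing of indices. Since the code of \<open>(j, i)\<close>
  increases with \<open>i\<close>, stage \<open>n\<close> of the \<open>j\<close>-th scheme depends only on coordinates up to the code of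
  \<open>(j, n)\<close>, which is the stage at which it is placed.
\<close>
lemma souslin_INT:
  fixes A :: "nat \<Rightarrow> 'a set"
  assumes A: "\<And>j. A j \<in> souslin \<E>"
  shows "(\<Inter>j. A j) \<in> souslin \<E>"
proof -
  obtain R where na: "\<And>j. nonanticipating (R j)" and R: "\<And>j n \<alpha>. R j n \<alpha> \<in> \<E>"
    and AR: "\<And>j. A j = (\<Union>\<alpha>. \<Inter>n. R j n \<alpha>)"
    by (rule souslinE[of A, OF A], rule that)
  define R' where "R' m \<alpha> = (case prod_decode m of (j, n) \<Rightarrow> R j n (\<lambda>i. \<alpha> (prod_encode (j, i))))" for m \<alpha>
  have "nonanticipating R'"
    unfolding nonanticipating_def
  proof (intro allI impI)
    fix m and \<alpha> \<beta> :: "nat \<Rightarrow> nat" assume eq: "\<forall>i\<le>m. \<alpha> i = \<beta> i"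
    obtain j n where jn: "prod_decode m = (j, n)" by fastforce
    then have m: "m = prod_encode (j, n)" by (metis prod_decode_inverse)
    have "R j n (\<lambda>i. \<alpha> (prod_encode (j, i))) = R j n (\<lambda>i. \<beta> (prod_encode (j, i)))"
      by (rule nonanticipatingD[OF na]) (use eq mono_prod_encode_snd m in blast)
    then show "R' m \<alpha> = R' m \<beta>" by (simp add: R'_def jn)
  qed
  moreover have "R' n \<alpha> \<in> \<E>" for n \<alpha>
    by (auto simp: R'_def R split: prod.split)
  moreover have "(\<Inter>j. A j) = (\<Union>\<alpha>. \<Inter>n. R' n \<alpha>)"
  proof (intro equalityI subsetI)
    fix x assume "x \<in> (\<Inter>j. A j)"
    then have "\<forall>j. \<exists>\<alpha>. \<forall>n. x \<in> R j n \<alpha>" by (auto simp: AR)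
    then obtain a where a: "\<And>j n. x \<in> R j n (a j)" by metis
    have "x \<in> R' m (\<lambda>k. case prod_decode k of (j, i) \<Rightarrow> a j i)" for m
      using a by (auto simp: R'_def split: prod.split)
    then show "x \<in> (\<Union>\<alpha>. \<Inter>n. R' n \<alpha>)" by blast
  next
    fix x assume "x \<in> (\<Union>\<alpha>. \<Inter>n. R' n \<alpha>)"
    then obtain \<alpha> where "\<And>n. x \<in> R' n \<alpha>" by blast
    from this[of "prod_encode (j, n)" for j n]
    have "x \<in> R j n (\<lambda>i. \<alpha> (prod_encode (j, i)))" for j n
      by (simp add: R'_def)
    then show "x \<in> (\<Inter>j. A j)" by (fastforce simp: AR)
  qed
  ultimately show ?thesis unfolding souslin_def by blast
qed

text \<open>
  The sets that are Souslin together with their complement form a sigma-algebra, because Souslin sets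
  are closed under countable unions and intersections. It contains the generators: open subsets of a
  metric space are countable unions of closed sets.
\<close>
lemma pair_sets_subset_souslin:
  fixes M :: "'a measure"
  defines "\<E> \<equiv> {a \<times> b |a b. a \<in> sets M \<and> closed (b :: 'q::metric_space set)}"
  assumes A: "A \<in> sets (M \<Otimes>\<^sub>M borel)"
  shows "A \<in> souslin \<E>"
proof -
  define \<Omega> where "\<Omega> = space M \<times> (UNIV :: 'q set)"
  have top: "\<Omega> \<in> \<E>" by (auto simp: \<Omega>_def \<E>_def)
  have sub: "E \<in> \<E> \<Longrightarrow> E \<subseteq> \<Omega>" for E
    using sets.sets_into_space by (fastforce simp: \<Omega>_def \<E>_def)
  \<comment> \<open>Souslin sets are not closed under complement, hence both conditions.\<close>
  define \<S> where "\<S> = {B. B \<subseteq> \<Omega> \<and> B \<in> souslin \<E> \<and> \<Omega> - B \<in> souslin \<E>}"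
  have empty: "{} \<in> \<E>" by (auto simp: \<E>_def)
  have "sigma_algebra \<Omega> \<S>"
    unfolding sigma_algebra_iff2
  proof (intro conjI ballI allI impI)
    show "{} \<in> \<S>" using top empty by (auto simp: \<S>_def souslin_basic)
    show "\<Omega> - s \<in> \<S>" if "s \<in> \<S>" for s
      using that by (auto simp: \<S>_def double_diff)
    show "\<Union> (range B) \<in> \<S>" if "range B \<subseteq> \<S>" for B :: "nat \<Rightarrow> _"
    proof -
      have B: "B j \<subseteq> \<Omega>" "B j \<in> souslin \<E>" "\<Omega> - B j \<in> souslin \<E>" for j
        using that by (auto simp: \<S>_def)
      have "\<Omega> - (\<Union>j. B j) = (\<Inter>j. \<Omega> - B j)" by auto
      then show ?thesis
        using souslin_UN[of B, OF B(2) top sub] souslin_INT[of "\<lambda>j. \<Omega> - B j", OF B(3)] B(1)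
        by (auto simp: \<S>_def)
    qed
  qed (auto simp: \<S>_def)
  then interpret S: sigma_algebra \<Omega> \<S> .
  define N where "N = sigma \<Omega> \<S>"
  have sN: "space N = \<Omega>" "sets N = \<S>"
    using S.sets_measure_of_eq S.space_measure_of_eq by (auto simp: N_def)
  have rect: "a \<times> UNIV \<in> \<S>" if "a \<in> sets M" for a
  proof -
    have "\<Omega> - a \<times> UNIV = (space M - a) \<times> UNIV" by (auto simp: \<Omega>_def)
    moreover have "a \<times> UNIV \<in> \<E>" "(space M - a) \<times> UNIV \<in> \<E>"
      using that by (auto simp: \<E>_def)
    ultimately show ?thesis using sub by (auto simp: \<S>_def souslin_basic)
  qed
  have open_rect: "space M \<times> U \<in> \<S>" if U: "open U" for U :: "'q set"
  proof -
    have "fsigma_in euclidean U"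
      using U by (intro open_imp_fsigma_in metrizable_space_euclidean) auto
    then obtain C where C: "\<And>n. closed (C n)" "U = (\<Union>n::nat. C n)"
      unfolding fsigma_in_ascending by auto
    have "(\<Union>n. space M \<times> C n) \<in> souslin \<E>"
      by (rule souslin_UN[OF _ top sub]) (use C(1) in \<open>auto intro!: souslin_basic simp: \<E>_def\<close>)
    moreover have "(\<Union>n. space M \<times> C n) = space M \<times> U" by (auto simp: C(2))
    moreover have "\<Omega> - space M \<times> U = space M \<times> (- U)" by (auto simp: \<Omega>_def)
    moreover have "space M \<times> (- U) \<in> \<E>" using U by (auto simp: \<E>_def)
    ultimately show ?thesis by (auto simp: \<S>_def souslin_basic \<Omega>_def)
  qed
  have snd: "snd \<in> N \<rightarrow>\<^sub>M (borel :: 'q measure)"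
  proof (rule borel_measurableI)
    fix U :: "'q set" assume "open U"
    moreover have "snd -` U \<inter> space N = space M \<times> U" by (auto simp: sN \<Omega>_def)
    ultimately show "snd -` U \<inter> space N \<in> sets N" using open_rect by (simp add: sN)
  qed
  have "sets (M \<Otimes>\<^sub>M borel) \<subseteq> sets N"
  proof (rule sets_pair_in_sets)
    fix a and b :: "'q set" assume a: "a \<in> sets M" and b: "b \<in> sets borel"
    have "a \<times> b = (a \<times> UNIV) \<inter> (snd -` b \<inter> space N)"
      using sets.sets_into_space[OF a] by (auto simp: sN \<Omega>_def)
    then show "a \<times> b \<in> sets N"
      using rect[OF a] measurable_sets[OF snd b] sets.Int by (metis sN(2))
  qed
  then show ?thesis using A by (auto simp: sN \<S>_def)
qed

section \<open>Measurable projection\<close>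

text \<open>
  Dependent choice of the coordinates of a sequence. It builds both the bounds of the finitely
  branching scheme and the branch in Koenig's lemma.
\<close>
lemma build_sequence:
  fixes P :: "nat \<Rightarrow> (nat \<Rightarrow> nat) \<Rightarrow> bool"
  assumes start: "P 0 \<alpha>\<^sub>0"
    and step: "\<And>n \<alpha>. P n \<alpha> \<Longrightarrow> \<exists>j. P (Suc n) (\<alpha>(n := j))"
    and local: "\<And>n \<alpha> \<beta>. P n \<alpha> \<Longrightarrow> (\<And>i. i < n \<Longrightarrow> \<alpha> i = \<beta> i) \<Longrightarrow> P n \<beta>"
  obtains \<alpha> where "\<And>n. P n \<alpha>"
proof -
  have "\<exists>f. \<forall>n. P n (f n) \<and> (\<exists>j. f (Suc n) = (f n)(n := j))"
    by (rule dependent_nat_choice) (use start step in blast)+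
  then obtain f where f: "\<And>n. P n (f n)" and fS: "\<And>n. \<exists>j. f (Suc n) = (f n)(n := j)"
    by blast
  define \<alpha> where "\<alpha> i = f (Suc i) i" for i
  have "f n i = \<alpha> i" if "i < n" for i n
    using that
  proof (induction n)
    case (Suc n)
    obtain j where "f (Suc n) = (f n)(n := j)" using fS by blast
    with Suc show ?case by (cases "i = n") (auto simp: \<alpha>_def)
  qed simp
  then have "P n \<alpha>" for n using local[OF f] by blast
  then show thesis by (rule that)
qed

text \<open>
  Koenig's lemma: a prefix is kept if it extends to admissible bounded branches of every length. If
  no continuation of a kept prefix could be kept, each of the finitely many candidates would fail at
  some length, contradicting the branch that exists at the largest of these lengths.
\<close>
lemma koenig_bounded:
  fixes b :: "nat \<Rightarrow> nat"
  assumes ex: "\<And>n. \<exists>\<alpha>. (\<forall>i\<le>n. \<alpha> i \<le> b i) \<and> S n \<alpha>"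
    and na: "nonanticipating S"
    and mono: "\<And>m n \<alpha>. m \<le> n \<Longrightarrow> S n \<alpha> \<Longrightarrow> S m \<alpha>"
  shows "\<exists>\<alpha>. \<forall>n. S n \<alpha>"
proof -
  define P where "P m \<alpha> \<longleftrightarrow> (\<forall>n. \<exists>\<beta>. (\<forall>i<m. \<alpha> i = \<beta> i) \<and> (\<forall>i\<le>n. \<beta> i \<le> b i) \<and> S n \<beta>)" for m \<alpha>
  have "P 0 (\<lambda>_. 0)" using ex by (auto simp: P_def)
  moreover have "\<exists>j. P (Suc m) (\<alpha>(m := j))" if P: "P m \<alpha>" for m \<alpha>
  proof (rule ccontr)
    assume "\<not> ?thesis"
    then have "\<forall>j. \<exists>n. \<not> (\<exists>\<beta>. (\<forall>i<Suc m. (\<alpha>(m := j)) i = \<beta> i) \<and> (\<forall>i\<le>n. \<beta> i \<le> b i) \<and> S n \<beta>)"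
      by (auto simp: P_def)
    then obtain n where n: "\<And>j. \<not> (\<exists>\<beta>. (\<forall>i<Suc m. (\<alpha>(m := j)) i = \<beta> i) \<and> (\<forall>i\<le>n j. \<beta> i \<le> b i) \<and> S (n j) \<beta>)"
      by metis
    \<comment> \<open>The maximum with \<open>m\<close> makes the bound \<open>b m\<close> available for the coordinate \<open>m\<close>.\<close>
    define N where "N = max m (Max (n ` {..b m}))"
    obtain \<beta> where \<beta>: "\<forall>i<m. \<alpha> i = \<beta> i" "\<forall>i\<le>N. \<beta> i \<le> b i" "S N \<beta>"
      using P unfolding P_def by metis
    have "\<beta> m \<le> b m" using \<beta>(2) by (simp add: N_def)
    then have "n (\<beta> m) \<le> N" by (auto simp: N_def intro!: max.coboundedI2 Max_ge)
    then have "\<forall>i\<le>n (\<beta> m). \<beta> i \<le> b i" "S (n (\<beta> m)) \<beta>"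
      using \<beta> mono by auto
    moreover have "\<forall>i<Suc m. (\<alpha>(m := \<beta> m)) i = \<beta> i" using \<beta>(1) by auto
    ultimately show False using n by blast
  qed
  moreover have "P m \<beta>" if "P m \<alpha>" "\<And>i. i < m \<Longrightarrow> \<alpha> i = \<beta> i" for m \<alpha> \<beta>
    using that by (auto simp: P_def)
  ultimately obtain \<alpha> where \<alpha>: "\<And>n. P n \<alpha>" using build_sequence[of P] by metis
  have "S n \<alpha>" for n
  proof -
    obtain \<beta> where "\<forall>i<Suc n. \<alpha> i = \<beta> i" "S n \<beta>"
      using \<alpha>[of "Suc n"] unfolding P_def by metis
    then show ?thesis using nonanticipatingD[OF na, of n \<alpha> \<beta>] by simp
  qed
  then show ?thesis by blast
qed

text \<open>
  The capacity argument. Outer measure is continuous along increasing unions of arbitrary sets, so the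
  coordinates of the branches can be bounded successively by \<open>b 0, b 1, \<dots>\<close> while the outer measure of
  the projection stays above \<open>t\<close>. With bounded branches only finitely many cells matter at each stage.
  The measurable sets \<open>D n\<close> of points that survive to stage \<open>n\<close> decrease, and a point in all of them
  lies on a single infinite branch, along which the closed sets of vanishing diameter
  have a common point.
\<close>
lemma souslin_projection_inner_approx:
  fixes K :: "nat \<Rightarrow> (nat \<Rightarrow> nat) \<Rightarrow> 'q::complete_space set"
  assumes "finite_measure M"
    and F: "\<And>n \<alpha>. F n \<alpha> \<in> sets M" "nonanticipating F"
    and K: "\<And>n \<alpha>. closed (K n \<alpha>)" "nonanticipating K"
    and diam: "\<And>n \<alpha> p q. p \<in> K n \<alpha> \<Longrightarrow> q \<in> K n \<alpha> \<Longrightarrow> dist p q \<le> 2 / real (Suc n)"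
    and t: "t < outer_measure_of M {w. \<exists>\<alpha> q. \<forall>n. w \<in> F n \<alpha> \<and> q \<in> K n \<alpha>}" (is "t < outer_measure_of M ?T")
  shows "\<exists>D\<in>sets M. D \<subseteq> ?T \<and> t \<le> emeasure M D"
proof -
  interpret finite_measure M by fact
  define T where "T n b = {w. \<exists>\<alpha> q. (\<forall>i<n. \<alpha> i \<le> b i) \<and> (\<forall>k. w \<in> F k \<alpha> \<and> q \<in> K k \<alpha>)}"
    for n and b :: "nat \<Rightarrow> nat"
  have T_space: "T n b \<subseteq> space M" for n b
    using sets.sets_into_space[OF F(1)] by (fastforce simp: T_def)
  obtain b where b: "\<And>n. t < outer_measure_of M (T n b)"
  proof (rule build_sequence[of "\<lambda>n b. t < outer_measure_of M (T n b)" "\<lambda>_. 0"])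
    show "t < outer_measure_of M (T 0 (\<lambda>_. 0))" using t by (simp add: T_def)
    show "\<exists>j. t < outer_measure_of M (T (Suc n) (b(n := j)))"
      if "t < outer_measure_of M (T n b)" for n b
    proof -
      \<comment> \<open>Raising the bound on coordinate \<open>n\<close> exhausts the set in which that coordinate is free.\<close>
      have "incseq (\<lambda>j. T (Suc n) (b(n := j)))"
        unfolding incseq_def T_def
        by (safe, rule exI, rule exI, rule conjI) (auto simp: less_Suc_eq)
      then have "(SUP j. outer_measure_of M (T (Suc n) (b(n := j)))) =
          outer_measure_of M (\<Union>j. T (Suc n) (b(n := j)))"
        by (intro SUP_outer_measure_of_incseq T_space)
      also have "(\<Union>j. T (Suc n) (b(n := j))) = T n b"
        by (auto simp: T_def less_Suc_eq)
      finally show ?thesis using that less_SUP_iff by (metis UNIV_I)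
    qed
    show "t < outer_measure_of M (T n b')"
      if "t < outer_measure_of M (T n b)" "\<And>i. i < n \<Longrightarrow> b i = b' i" for n b b'
    proof -
      have "T n b = T n b'" using that(2) by (auto simp: T_def)
      with that(1) show ?thesis by simp
    qed
  qed (rule that)
  define D where "D n = (\<Union>\<alpha>\<in>{\<alpha>\<in>PiE {..n} (\<lambda>i. {..b i}). \<exists>q. \<forall>k\<le>n. q \<in> K k \<alpha>}. \<Inter>k\<le>n. F k \<alpha>)" for n
  have D_iff: "w \<in> D n \<longleftrightarrow> (\<exists>\<alpha>. (\<forall>i\<le>n. \<alpha> i \<le> b i) \<and> (\<forall>k\<le>n. w \<in> F k \<alpha>) \<and> (\<exists>q. \<forall>k\<le>n. q \<in> K k \<alpha>))"
    (is "_ \<longleftrightarrow> ?rhs") for w n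
  proof
    assume ?rhs
    then obtain \<alpha> q where \<alpha>: "\<forall>i\<le>n. \<alpha> i \<le> b i" "\<forall>k\<le>n. w \<in> F k \<alpha>" "\<forall>k\<le>n. q \<in> K k \<alpha>" by blast
    \<comment> \<open>Cutting the branch after stage \<open>n\<close> leaves a finite index set, which makes \<open>D n\<close> measurable.\<close>
    have "F k (restrict \<alpha> {..n}) = F k \<alpha>" "K k (restrict \<alpha> {..n}) = K k \<alpha>" if "k \<le> n" for k
      using that by (auto intro!: nonanticipatingD[OF F(2)] nonanticipatingD[OF K(2)])
    then show "w \<in> D n" using \<alpha> unfolding D_def
      by (intro UN_I[of "restrict \<alpha> {..n}"]) auto
  qed (auto simp: D_def PiE_def Pi_def)
  have D_sets: "D n \<in> sets M" for n
    unfolding D_def by (intro sets.finite_UN finite_subset[OF _ finite_PiE[of "{..n}" "\<lambda>i. {..b i}"]] sets.finite_INT)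
      (auto simp: F)
  have D_dec: "decseq D"
    by (intro decseq_SucI subsetI) (metis D_iff le_Suc_eq)
  have D_ge: "t \<le> emeasure M (D n)" for n
  proof -
    have "T (Suc n) b \<subseteq> D n"
      unfolding T_def subset_iff D_iff by (auto simp: less_Suc_eq_le)
    then have "outer_measure_of M (T (Suc n) b) \<le> emeasure M (D n)"
      using outer_measure_of_mono outer_measure_of_eq[OF D_sets] by metis
    with b[of "Suc n"] show ?thesis by simp
  qed
  have "(\<Inter>n. D n) \<in> sets M" using D_sets by auto
  moreover have "t \<le> emeasure M (\<Inter>n. D n)"
    using INF_emeasure_decseq'[OF D_sets D_dec] D_ge
    by (metis INF_greatest emeasure_finite infinity_ennreal_def)
  moreover have "(\<Inter>n. D n) \<subseteq> ?T"
  proof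
    fix w assume w: "w \<in> (\<Inter>n. D n)"
    define S where "S n \<alpha> \<longleftrightarrow> (\<forall>k\<le>n. w \<in> F k \<alpha>) \<and> (\<exists>q. \<forall>k\<le>n. q \<in> K k \<alpha>)" for n \<alpha>
    have "\<exists>\<alpha>. \<forall>n. S n \<alpha>"
    proof (rule koenig_bounded)
      show "\<exists>\<alpha>. (\<forall>i\<le>n. \<alpha> i \<le> b i) \<and> S n \<alpha>" for n
        using w D_iff by (auto simp: S_def)
      show "nonanticipating S"
        unfolding nonanticipating_def
      proof (intro allI impI)
        fix n and \<alpha> \<beta> :: "nat \<Rightarrow> nat" assume eq: "\<forall>i\<le>n. \<alpha> i = \<beta> i"
        have "F k \<alpha> = F k \<beta>" "K k \<alpha> = K k \<beta>" if "k \<le> n" for k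
          using that eq by (auto intro!: nonanticipatingD[OF F(2)] nonanticipatingD[OF K(2)])
        then show "S n \<alpha> = S n \<beta>" by (auto simp: S_def)
      qed
      show "S m \<alpha>" if "m \<le> n" "S n \<alpha>" for m n \<alpha>
        using that by (auto simp: S_def) (meson order_trans)
    qed
    then obtain \<alpha> where wF: "\<And>n. w \<in> F n \<alpha>" and ne: "\<And>n. \<exists>q. \<forall>k\<le>n. q \<in> K k \<alpha>"
      by (auto simp: S_def)
    obtain q where "\<And>n. q \<in> (\<Inter>k\<le>n. K k \<alpha>)"
    proof (rule decreasing_closed_nest[of "\<lambda>n. \<Inter>k\<le>n. K k \<alpha>"])
      show "\<exists>n. \<forall>x\<in>\<Inter>k\<le>n. K k \<alpha>. \<forall>y\<in>\<Inter>k\<le>n. K k \<alpha>. dist x y < e" if "e > 0" for e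
      proof -
        obtain n where n: "inverse (real (Suc n)) < e / 2"
          using reals_Archimedean[of "e / 2"] \<open>e > 0\<close> half_gt_zero by blast
        have "dist x y < e" if "x \<in> (\<Inter>k\<le>n. K k \<alpha>)" "y \<in> (\<Inter>k\<le>n. K k \<alpha>)" for x y
        proof -
          have "dist x y \<le> 2 / real (Suc n)" using diam[of x n \<alpha> y] that by auto
          also have "\<dots> = 2 * inverse (real (Suc n))" by (simp only: divide_inverse)
          finally show ?thesis using n by linarith
        qed
        then show ?thesis by blast
      qed
      show "closed (\<Inter>k\<le>n. K k \<alpha>)" for n using K(1) by (intro closed_INT) auto
      show "(\<Inter>k\<le>n. K k \<alpha>) \<noteq> {}" for n using ne[of n] by blast
      show "(\<Inter>k\<le>n. K k \<alpha>) \<subseteq> (\<Inter>k\<le>m. K k \<alpha>)" if "m \<le> n" for m n using that by auto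
    qed (rule that)
    then have "\<And>n. q \<in> K n \<alpha>" by blast
    with wF show "w \<in> ?T" by blast
  qed
  ultimately show ?thesis by blast
qed

text \<open>
  A set whose outer measure is approached by measurable subsets differs from a measurable hull by a
  null set.
\<close>
lemma inner_approx_in_completion:
  assumes "finite_measure M" and T: "T \<subseteq> space M"
    and inner: "\<And>t. t < outer_measure_of M T \<Longrightarrow> \<exists>D\<in>sets M. D \<subseteq> T \<and> t \<le> emeasure M D"
  shows "T \<in> sets (completion M)"
proof -
  interpret finite_measure M by fact
  obtain E where E: "E \<in> sets M" "T \<subseteq> E" "outer_measure_of M T = emeasure M E"
    using outer_measure_of_attain[OF T] by blast
  have "\<exists>D\<in>sets M. D \<subseteq> T \<and> emeasure M E \<le> emeasure M D"
  proof (cases "emeasure M E = 0")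
    case False
    define \<C> where "\<C> = {D\<in>sets M. D \<subseteq> T}"
    have "\<C> \<noteq> {}" by (auto simp: \<C>_def)
    then obtain f where f: "range f \<subseteq> emeasure M ` \<C>" "(SUP D\<in>\<C>. emeasure M D) = (SUP n::nat. f n)"
      using ennreal_SUP_countable_SUP[of \<C> "emeasure M"] by auto
    then have "\<forall>n. \<exists>D. D \<in> \<C> \<and> f n = emeasure M D" by blast
    then obtain D where D: "\<And>n. D n \<in> \<C>" "\<And>n. f n = emeasure M (D n)" by metis
    have "emeasure M E \<le> (SUP D\<in>\<C>. emeasure M D)"
    proof (rule dense_le)
      fix t assume "t < emeasure M E"
      then obtain D where "D \<in> \<C>" "t \<le> emeasure M D" using inner E(3) by (auto simp: \<C>_def)
      then show "t \<le> (SUP D\<in>\<C>. emeasure M D)" by (meson SUP_upper2)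
    qed
    also have "\<dots> \<le> emeasure M (\<Union>n. D n)"
      unfolding f(2) D(2) using D(1) by (intro SUP_least emeasure_mono) (auto simp: \<C>_def)
    finally show ?thesis using D(1) by (intro bexI[of _ "\<Union>n. D n"]) (auto simp: \<C>_def)
  qed (auto intro!: bexI[of _ "{}"])
  then obtain D where D: "D \<in> sets M" "D \<subseteq> T" "emeasure M E \<le> emeasure M D" by blast
  have "emeasure M (E - D) = 0"
    using D E by (subst emeasure_Diff) (auto simp: diff_eq_0_iff_ennreal less_top[symmetric])
  then have "E - D \<in> null_sets M" using D E by auto
  then show ?thesis
    using D E by (intro sets_completionI[of T D "T - D" "E - D"]) auto
qed

text \<open>
  In a Souslin scheme for \<open>A\<close> the closed factors need not have small diameter. Each coordinate is
  therefore made to code also the index of a ball of radius \<open>1 / (n + 1)\<close> around a point of a countable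
  dense sequence; every \<open>q\<close> lies in such a ball at every stage, so the projection is unchanged.
\<close>
theorem measurable_projection:
  fixes A :: "('a \<times> 'q::polish_space) set"
  assumes M: "finite_measure M" and A: "A \<in> sets (M \<Otimes>\<^sub>M borel)"
  shows "fst ` A \<in> sets (completion M)"
proof -
  define \<E> where "\<E> = {a \<times> b |a b. a \<in> sets M \<and> closed (b :: 'q set)}"
  have "A \<in> souslin \<E>"
    using pair_sets_subset_souslin[OF A] by (simp add: \<E>_def)
  then obtain R where R: "nonanticipating R" "\<And>n \<alpha>. R n \<alpha> \<in> \<E>" and AR: "A = (\<Union>\<alpha>. \<Inter>n. R n \<alpha>)"
    unfolding souslin_def by auto
  have "\<forall>E\<in>\<E>. \<exists>a b. a \<in> sets M \<and> closed b \<and> E = a \<times> b" by (auto simp: \<E>_def)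
  then obtain fa fb where f: "\<And>E. E \<in> \<E> \<Longrightarrow> fa E \<in> sets M \<and> closed (fb E) \<and> E = fa E \<times> fb E"
    by metis
  obtain Q :: "'q set" where Q: "countable Q" "\<And>U. open U \<Longrightarrow> U \<noteq> {} \<Longrightarrow> \<exists>d\<in>Q. d \<in> U"
    using countable_dense_setE by metis
  define x where "x = from_nat_into Q"
  have near: "\<exists>k. dist (x k) q \<le> e" if "e > 0" for q e
  proof -
    have "\<exists>d\<in>Q. d \<in> ball q e"
      using that by (intro Q(2)) auto
    then obtain d where "d \<in> Q" "d \<in> ball q e" by blast
    moreover obtain k where "x k = d"
      using \<open>d \<in> Q\<close> Q(1) unfolding x_def by (meson from_nat_into_surj)
    ultimately show ?thesis by (auto simp: dist_commute intro!: exI[of _ k])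
  qed
  define fst' where "fst' \<gamma> = (\<lambda>i. fst (prod_decode (\<gamma> i)))" for \<gamma> :: "nat \<Rightarrow> nat"
  define F where "F n \<gamma> = fa (R n (fst' \<gamma>))" for n \<gamma>
  define K where "K n \<gamma> = fb (R n (fst' \<gamma>)) \<inter> cball (x (snd (prod_decode (\<gamma> n)))) (1 / real (Suc n))" for n \<gamma>
  have R_eq: "R n (fst' \<alpha>) = R n (fst' \<beta>)" if "\<forall>i\<le>n. \<alpha> i = \<beta> i" for n \<alpha> \<beta>
    by (rule nonanticipatingD[OF R(1)]) (use that in \<open>simp add: fst'_def\<close>)
  have naF: "nonanticipating F"
    unfolding nonanticipating_def F_def
    by (intro allI impI arg_cong[where f = fa] R_eq) blast
  have naK: "nonanticipating K"
    unfolding nonanticipating_def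
  proof (intro allI impI)
    fix n and \<alpha> \<beta> :: "nat \<Rightarrow> nat" assume eq: "\<forall>i\<le>n. \<alpha> i = \<beta> i"
    show "K n \<alpha> = K n \<beta>" using R_eq[OF eq] eq by (simp add: K_def)
  qed
  have diam: "dist p q \<le> 2 / real (Suc n)" if "p \<in> K n \<alpha>" "q \<in> K n \<alpha>" for n \<alpha> p q
  proof -
    have "dist p q \<le> dist p (x (snd (prod_decode (\<alpha> n)))) + dist q (x (snd (prod_decode (\<alpha> n))))"
      by (rule dist_triangle2)
    also have "\<dots> \<le> 1 / real (Suc n) + 1 / real (Suc n)"
      using that by (intro add_mono) (auto simp: K_def dist_commute)
    finally show ?thesis by simp
  qed
  have proj: "fst ` A = {w. \<exists>\<alpha> q. \<forall>n. w \<in> F n \<alpha> \<and> q \<in> K n \<alpha>}"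
  proof (intro equalityI subsetI)
    fix w assume "w \<in> fst ` A"
    then have "\<exists>q \<alpha>. \<forall>n. (w, q) \<in> R n \<alpha>" unfolding AR by fastforce
    then obtain q \<alpha> where wq: "\<And>n. (w, q) \<in> R n \<alpha>" by blast
    have "\<forall>n. \<exists>k. dist (x k) q \<le> 1 / real (Suc n)" using near by simp
    then obtain k where k: "\<And>n. dist (x (k n)) q \<le> 1 / real (Suc n)" by metis
    have "w \<in> fa (R n \<alpha>)" "q \<in> fb (R n \<alpha>)" for n
      using wq[of n] f[OF R(2)[of n \<alpha>]] by auto
    then have "w \<in> F n (\<lambda>n. prod_encode (\<alpha> n, k n))" "q \<in> K n (\<lambda>n. prod_encode (\<alpha> n, k n))" for n
      using k[of n] by (simp_all add: F_def K_def fst'_def del: of_nat_Suc)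
    then show "w \<in> {w. \<exists>\<alpha> q. \<forall>n. w \<in> F n \<alpha> \<and> q \<in> K n \<alpha>}" by blast
  next
    fix w assume "w \<in> {w. \<exists>\<alpha> q. \<forall>n. w \<in> F n \<alpha> \<and> q \<in> K n \<alpha>}"
    then obtain \<gamma> q where "\<And>n. w \<in> F n \<gamma>" "\<And>n. q \<in> K n \<gamma>" by blast
    then have "(w, q) \<in> R n (fst' \<gamma>)" for n
      using f[OF R(2)[of n "fst' \<gamma>"]] by (metis F_def IntD1 K_def mem_Sigma_iff)
    then have "(w, q) \<in> A" unfolding AR by blast
    then show "w \<in> fst ` A" by (metis fst_conv image_eqI)
  qed
  show ?thesis
  proof (rule inner_approx_in_completion[OF M])
    show "fst ` A \<subseteq> space M"
      using sets.sets_into_space[OF A] by (auto simp: space_pair_measure)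
    fix t assume "t < outer_measure_of M (fst ` A)"
    moreover have "F n \<alpha> \<in> sets M" "closed (K n \<alpha>)" for n \<alpha>
      using f[OF R(2)[of n "fst' \<alpha>"]] by (simp_all add: F_def K_def closed_Int)
    ultimately show "\<exists>D\<in>sets M. D \<subseteq> fst ` A \<and> t \<le> emeasure M D"
      unfolding proj by (intro souslin_projection_inner_approx[OF M _ naF _ naK diam])
  qed
qed


section \<open>The strong law of large numbers\<close>

text \<open>
  Needed both for the shifted sequence and for passing from indices starting at \<open>1\<close> to indices
  starting at \<open>0\<close>.
\<close>
lemma (in prob_space) indep_vars_reindex:
  assumes indep: "indep_vars M' X (f ` I)" and f: "inj_on f I"
  shows "indep_vars (\<lambda>i. M' (f i)) (\<lambda>i. X (f i)) I"
proof -
  let ?A = "\<lambda>i. {X i -` A \<inter> space M |A. A \<in> sets (M' i)}"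
  have "indep_sets (\<lambda>i. ?A (f i)) I"
  proof (rule indep_setsI)
    fix G J assume J: "J \<noteq> {}" "J \<subseteq> I" "finite J" "\<forall>j\<in>J. G j \<in> ?A (f j)"
    define g where "g = the_inv_into I f"
    have g: "g (f j) = j" if "j \<in> J" for j
      using that J(2) f by (auto simp: g_def the_inv_into_f_f)
    have inj: "inj_on f J" using f J(2) by (rule inj_on_subset)
    have "prob (\<Inter>k\<in>f ` J. G (g k)) = (\<Prod>k\<in>f ` J. prob (G (g k)))"
      using indep J g unfolding indep_vars_def2 by (intro indep_setsD[of ?A "f ` I"]) auto
    also have "\<dots> = (\<Prod>j\<in>J. prob (G j))"
      using g by (simp add: prod.reindex[OF inj])
    also have "(\<Inter>k\<in>f ` J. G (g k)) = (\<Inter>j\<in>J. G j)" using g by auto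
    finally show "prob (\<Inter>j\<in>J. G j) = (\<Prod>j\<in>J. prob (G j))" .
  qed (use indep in \<open>auto simp: indep_vars_def2 indep_sets_def\<close>)
  with indep show ?thesis by (auto simp: indep_vars_def2)
qed

text \<open>
  The minimum of \<open>0, x 0, x 0 + x 1, \<dots>\<close> up to the sum of the first \<open>n\<close> terms, in the recursive form that
  relates it to the minimum for the shifted sequence; the maximal inequality uses exactly this relation.
\<close>
fun min_partial_sum :: "nat \<Rightarrow> (nat \<Rightarrow> real) \<Rightarrow> real" where
  "min_partial_sum 0 x = 0"
| "min_partial_sum (Suc n) x = min 0 (x 0 + min_partial_sum n (\<lambda>i. x (Suc i)))"

lemma min_partial_sum_nonpos: "min_partial_sum n x \<le> 0"
  by (cases n) auto

lemma min_partial_sum_antimono: "min_partial_sum (Suc n) x \<le> min_partial_sum n x"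
proof (induction n arbitrary: x)
  case (Suc n)
  from Suc[of "\<lambda>i. x (Suc i)"] show ?case
    by (simp del: min_partial_sum.simps add: min_partial_sum.simps(2)[of "Suc n" x] min_partial_sum.simps(2)[of n x])
qed simp

lemma min_partial_sum_le: "k \<le> n \<Longrightarrow> min_partial_sum n x \<le> (\<Sum>i<k. x i)"
proof (induction n arbitrary: k x)
  case (Suc n)
  show ?case
  proof (cases k)
    case (Suc j)
    then have "min_partial_sum n (\<lambda>i. x (Suc i)) \<le> (\<Sum>i<j. x (Suc i))"
      using Suc.IH[of j] Suc.prems by simp
    then show ?thesis by (simp add: Suc sum.lessThan_Suc_shift del: sum.lessThan_Suc)
  qed simp
qed simp

lemma min_partial_sum_bound: "\<bar>min_partial_sum n x\<bar> \<le> (\<Sum>i<n. \<bar>x i\<bar>)"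
proof (induction n arbitrary: x)
  case (Suc n)
  from Suc[of "\<lambda>i. x (Suc i)"] show ?case
    by (auto simp: sum.lessThan_Suc_shift min_def simp del: sum.lessThan_Suc)
qed simp

lemma measurable_min_partial_sum [measurable]:
  "min_partial_sum n \<in> borel_measurable (\<Pi>\<^sub>M i\<in>UNIV. borel)"
proof (induction n)
  case (Suc n)
  note [measurable] = Suc
  have [measurable]: "(\<lambda>x i. x (Suc i)) \<in> (\<Pi>\<^sub>M i\<in>UNIV. borel :: real measure) \<rightarrow>\<^sub>M (\<Pi>\<^sub>M i\<in>UNIV. borel)"
    by (rule measurable_PiM_single') (auto simp: space_PiM)
  show ?case by simp
qed simp

context prob_space
begin

context
  fixes X :: "nat \<Rightarrow> 'a \<Rightarrow> real"
  assumes indep: "indep_vars (\<lambda>_. borel) X UNIV"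
    and ident: "\<And>i. distr M borel (X i) = distr M borel (X 0)"
    and int: "integrable M (X 0)"
begin

lemma iid_measurable [measurable]: "X i \<in> borel_measurable M"
  using indep unfolding indep_vars_def2 by blast

lemma iid_integrable: "integrable M (X i)"
proof -
  have "integrable (distr M borel (X i)) (\<lambda>x. x)"
    unfolding ident[of i] using int by (subst integrable_distr_eq) auto
  then show ?thesis by (subst (asm) integrable_distr_eq) auto
qed

lemma iid_shift_distr:
  "distr M (\<Pi>\<^sub>M i\<in>UNIV. borel) (\<lambda>\<omega> i. X (Suc i) \<omega>) = distr M (\<Pi>\<^sub>M i\<in>UNIV. borel) (\<lambda>\<omega> i. X i \<omega>)"
proof -
  have "indep_vars (\<lambda>_. borel) (\<lambda>i. X (Suc i)) UNIV"
    using indep_vars_reindex[of "\<lambda>_. borel" X Suc UNIV] indep_vars_subset[OF indep] by simp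
  then have "distr M (\<Pi>\<^sub>M i\<in>UNIV. borel) (\<lambda>\<omega> i. X (Suc i) \<omega>) = (\<Pi>\<^sub>M i\<in>UNIV. distr M borel (X (Suc i)))"
    by (subst (asm) indep_vars_iff_distr_eq_PiM') (auto simp: restrict_UNIV)
  also have "\<dots> = (\<Pi>\<^sub>M i\<in>UNIV. distr M borel (X i))"
    by (intro PiM_cong refl) (metis ident)
  also have "\<dots> = distr M (\<Pi>\<^sub>M i\<in>UNIV. borel) (\<lambda>\<omega> i. X i \<omega>)"
    using indep by (subst (asm) indep_vars_iff_distr_eq_PiM') (auto simp: restrict_UNIV)
  finally show ?thesis .
qed

text \<open>
  On the event the recursion gives \<open>X 0\<close> as the minimum for \<open>X\<close> with \<open>n + 1\<close> terms minus the minimum for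
  the shifted sequence with \<open>n\<close> terms; off the event that difference is nonnegative. The shifted sequence
  has the same law, so the integral of the difference is that of a decrement of the minimum, which is at
  most \<open>0\<close>.
\<close>
lemma maximal_inequality:
  "(\<integral>\<omega>. X 0 \<omega> * indicator {\<omega>. min_partial_sum (Suc n) (\<lambda>i. X i \<omega>) < 0} \<omega> \<partial>M) \<le> 0"
proof -
  let ?m = "\<lambda>n \<omega>. min_partial_sum n (\<lambda>i. X i \<omega>)"
  let ?s = "\<lambda>n \<omega>. min_partial_sum n (\<lambda>i. X (Suc i) \<omega>)"
  have [measurable]: "(\<lambda>\<omega> i. X i \<omega>) \<in> M \<rightarrow>\<^sub>M (\<Pi>\<^sub>M i\<in>UNIV. borel)"
    "(\<lambda>\<omega> i. X (Suc i) \<omega>) \<in> M \<rightarrow>\<^sub>M (\<Pi>\<^sub>M i\<in>UNIV. borel)"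
    by (auto intro!: measurable_PiM_single')
  have intm: "integrable M (?m n)" for n
    by (rule Bochner_Integration.integrable_bound[where f = "\<lambda>\<omega>. \<Sum>i<n. \<bar>X i \<omega>\<bar>"])
      (auto intro!: integrable_sum integrable_abs iid_integrable min_partial_sum_bound order_trans[OF min_partial_sum_bound])
  have ints: "integrable M (?s n)" for n
    by (rule Bochner_Integration.integrable_bound[where f = "\<lambda>\<omega>. \<Sum>i<n. \<bar>X (Suc i) \<omega>\<bar>"])
      (auto intro!: integrable_sum integrable_abs iid_integrable min_partial_sum_bound order_trans[OF min_partial_sum_bound])
  have "(\<integral>\<omega>. ?s n \<omega> \<partial>M) = (\<integral>x. min_partial_sum n x \<partial>distr M (\<Pi>\<^sub>M i\<in>UNIV. borel) (\<lambda>\<omega> i. X (Suc i) \<omega>))"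
    by (subst integral_distr) auto
  also have "\<dots> = (\<integral>\<omega>. ?m n \<omega> \<partial>M)"
    unfolding iid_shift_distr by (subst integral_distr) auto
  finally have shift: "(\<integral>\<omega>. ?s n \<omega> \<partial>M) = (\<integral>\<omega>. ?m n \<omega> \<partial>M)" .
  have "(\<integral>\<omega>. X 0 \<omega> * indicator {\<omega>. ?m (Suc n) \<omega> < 0} \<omega> \<partial>M) \<le> (\<integral>\<omega>. ?m (Suc n) \<omega> - ?s n \<omega> \<partial>M)"
  proof (rule integral_mono)
    show "integrable M (\<lambda>\<omega>. X 0 \<omega> * indicator {\<omega>. ?m (Suc n) \<omega> < 0} \<omega>)"
      by (rule Bochner_Integration.integrable_bound[OF iid_integrable[of 0]])
        (auto simp: indicator_def simp del: min_partial_sum.simps)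
    show "X 0 \<omega> * indicator {\<omega>. ?m (Suc n) \<omega> < 0} \<omega> \<le> ?m (Suc n) \<omega> - ?s n \<omega>" for \<omega>
      using min_partial_sum_nonpos[of n "\<lambda>i. X (Suc i) \<omega>"] by (auto simp: indicator_def min_def)
  qed (intro Bochner_Integration.integrable_diff intm ints)
  also have "\<dots> = (\<integral>\<omega>. ?m (Suc n) \<omega> \<partial>M) - (\<integral>\<omega>. ?m n \<omega> \<partial>M)"
    by (subst Bochner_Integration.integral_diff[OF intm ints]) (simp only: shift)
  also have "\<dots> \<le> 0"
  proof -
    have "(\<integral>\<omega>. ?m (Suc n) \<omega> \<partial>M) \<le> (\<integral>\<omega>. ?m n \<omega> \<partial>M)"
      by (intro integral_mono intm min_partial_sum_antimono)
    then show ?thesis by (simp del: min_partial_sum.simps)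
  qed
  finally show ?thesis .
qed

text \<open>
  The events of the maximal inequality exhaust almost all of the space when \<open>n\<close> grows.
\<close>
lemma expectation_nonpos_if_sums_go_negative:
  assumes neg: "AE \<omega> in M. \<exists>k. (\<Sum>i<k. X i \<omega>) < 0"
  shows "expectation (X 0) \<le> 0"
proof -
  let ?A = "\<lambda>n. {\<omega>. min_partial_sum (Suc n) (\<lambda>i. X i \<omega>) < 0}"
  have [measurable]: "(\<lambda>\<omega> i. X i \<omega>) \<in> M \<rightarrow>\<^sub>M (\<Pi>\<^sub>M i\<in>UNIV. borel)"
    by (auto intro!: measurable_PiM_single')
  have "(\<lambda>n. \<integral>\<omega>. X 0 \<omega> * indicator (?A n) \<omega> \<partial>M) \<longlonglongrightarrow> expectation (X 0)"
  proof (rule integral_dominated_convergence[where w = "\<lambda>\<omega>. \<bar>X 0 \<omega>\<bar>"])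
    show "AE \<omega> in M. (\<lambda>n. X 0 \<omega> * indicator (?A n) \<omega>) \<longlonglongrightarrow> X 0 \<omega>"
      using neg
    proof eventually_elim
      fix \<omega> assume "\<exists>k. (\<Sum>i<k. X i \<omega>) < 0"
      then obtain k where k: "(\<Sum>i<k. X i \<omega>) < 0" by blast
      have "\<forall>\<^sub>F n in sequentially. X 0 \<omega> * indicator (?A n) \<omega> = X 0 \<omega>"
        using eventually_ge_at_top[of k]
      proof eventually_elim
        fix n assume "k \<le> n"
        then have "\<omega> \<in> ?A n" using min_partial_sum_le[of k "Suc n" "\<lambda>i. X i \<omega>"] k
          by (simp del: min_partial_sum.simps)
        then show "X 0 \<omega> * indicator (?A n) \<omega> = X 0 \<omega>" by simp
      qed
      then show "(\<lambda>n. X 0 \<omega> * indicator (?A n) \<omega>) \<longlonglongrightarrow> X 0 \<omega>" by (rule tendsto_eventually)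
    qed
  qed (auto simp: indicator_def int simp del: min_partial_sum.simps)
  then show ?thesis
    by (rule LIMSEQ_le_const2) (use maximal_inequality in blast)
qed

text \<open>
  Kolmogorov's law for an event that depends only on \<open>X m, X (m + 1), \<dots>\<close>, for every \<open>m\<close>.
\<close>
lemma prob_tail_event_0_1:
  fixes C :: "'a set"
  assumes C: "\<And>m. C \<in> sigma_sets (space M) (\<Union>i\<in>{m..}. {X i -` B \<inter> space M |B. B \<in> sets borel})"
  shows "prob C = 0 \<or> prob C = 1"
proof (rule kolmogorov_0_1_law)
  let ?A = "\<lambda>i. sigma_sets (space M) {X i -` B \<inter> space M |B. B \<in> sets borel}"
  show "sigma_algebra (space M) (?A i)" for i
    by (rule sigma_algebra_sigma_sets) auto
  show "indep_sets ?A UNIV"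
    using indep by (simp add: indep_vars_def)
  show "C \<in> tail_events ?A"
    unfolding tail_events_def
  proof (intro INT_I)
    fix m show "C \<in> sigma_sets (space M) (\<Union> (?A ` {m..}))"
      by (rule rev_subsetD[OF C[of m] sigma_sets_mono]) (auto intro: sigma_sets.Basic)
  qed
qed

text \<open>
  The event says that the lower limit of the averages is nonnegative. Dropping finitely many terms does
  not affect it, so its probability is \<open>0\<close> or \<open>1\<close>; probability \<open>0\<close> would make the partial sums negative
  at some time almost surely, against the positive mean.
\<close>
lemma eventually_average_lower_bound_if_expectation_pos:
  assumes pos: "expectation (X 0) > 0"
  shows "AE \<omega> in M. \<forall>k. \<exists>N. \<forall>n\<ge>N. (\<Sum>i<n. X i \<omega>) \<ge> - (real n / real (Suc k))"
proof -
  let ?S = "\<lambda>m n \<omega>. \<Sum>i=m..<n. X i \<omega>"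
  define C where "C m = {\<omega>\<in>space M. \<forall>k. \<exists>N. \<forall>n\<ge>N. ?S m n \<omega> \<ge> - (real n / real (Suc k))}" for m
  have sub: "\<omega> \<in> C m'" if "\<omega> \<in> C m" for \<omega> m m'
  proof -
    have "\<exists>N. \<forall>n\<ge>N. ?S m' n \<omega> \<ge> - (real n / real (Suc k))" for k
    proof -
      \<comment> \<open>Sums started at \<open>m\<close> and at \<open>m'\<close> differ by the constant \<open>d\<close>, which half of the allowance \<open>n / (k + 1)\<close> absorbs for large \<open>n\<close>.\<close>
      define d where "d = ?S 0 m \<omega> - ?S 0 m' \<omega>"
      obtain N where N: "\<And>n. n \<ge> N \<Longrightarrow> ?S m n \<omega> \<ge> - (real n / real (Suc (2 * k + 1)))"
        using \<open>\<omega> \<in> C m\<close> unfolding C_def by blast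
      obtain K where K: "\<bar>d\<bar> * (2 * real (Suc k)) \<le> real K"
        using real_arch_simple by blast
      have "?S m' n \<omega> \<ge> - (real n / real (Suc k))" if "n \<ge> N + K + m + m'" for n
      proof -
        have "?S 0 n \<omega> = ?S 0 m \<omega> + ?S m n \<omega>" "?S 0 n \<omega> = ?S 0 m' \<omega> + ?S m' n \<omega>"
          using that by (simp_all add: sum.atLeastLessThan_concat)
        then have eq: "?S m' n \<omega> = ?S m n \<omega> + d" by (simp add: d_def)
        have "\<bar>d\<bar> * (2 * real (Suc k)) \<le> real n" using K that by linarith
        define h where "h = real n / (2 * real (Suc k))"
        have "\<bar>d\<bar> \<le> h"
          using \<open>\<bar>d\<bar> * (2 * real (Suc k)) \<le> real n\<close> by (simp add: h_def pos_le_divide_eq)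
        moreover have "real (Suc (2 * k + 1)) = 2 * real (Suc k)" by simp
        then have "- h \<le> ?S m n \<omega>"
          using N[of n] that unfolding h_def by (metis add_leE)
        moreover have "real n / real (Suc k) = h + h"
          using field_sum_of_halves[of "real n / real (Suc k)"]
          by (simp add: h_def mult.commute del: of_nat_Suc)
        ultimately show ?thesis unfolding eq by linarith
      qed
      then show ?thesis by blast
    qed
    then show ?thesis using that by (auto simp: C_def)
  qed
  have C_eq: "C m = C 0" for m using sub by blast
  have tail: "C 0 \<in> sigma_sets (space M) (\<Union>i\<in>{m..}. {X i -` B \<inter> space M |B. B \<in> sets borel})" for m
  proof -
    let ?G = "\<Union>i\<in>{m..}. {X i -` B \<inter> space M |B. B \<in> sets borel}"
    define N where "N = sigma (space M) ?G"
    have G: "?G \<subseteq> Pow (space M)" by auto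
    have sp: "space N = space M" unfolding N_def by (rule space_measure_of[OF G])
    have sN: "sets N = sigma_sets (space M) ?G" unfolding N_def by (rule sets_measure_of[OF G])
    have [measurable]: "X i \<in> borel_measurable N" if "i \<ge> m" for i
    proof (rule measurableI)
      fix B :: "real set" assume "B \<in> sets borel"
      then show "X i -` B \<inter> space N \<in> sets N"
        unfolding sp sN using that by (intro sigma_sets.Basic) blast
    qed simp
    have [measurable]: "(\<lambda>\<omega>. ?S m n \<omega>) \<in> borel_measurable N" for n
      by (rule borel_measurable_sum) auto
    have "{\<omega>\<in>space N. \<forall>k. \<exists>K. \<forall>n\<ge>K. ?S m n \<omega> \<ge> - (real n / real (Suc k))} \<in> sets N"
      by measurable
    then show ?thesis
      unfolding C_eq[of m, symmetric] by (simp add: C_def sp sN)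
  qed
  have meas: "C 0 \<in> events" unfolding C_def by measurable
  have "prob (C 0) \<noteq> 0"
  proof
    assume "prob (C 0) = 0"
    then have "AE \<omega> in M. \<omega> \<notin> C 0"
      using meas by (simp add: prob_eq_0)
    then have "AE \<omega> in M. \<exists>k. (\<Sum>i<k. X i \<omega>) < 0"
      using AE_space
    proof eventually_elim
      case (elim \<omega>)
      then obtain k n where "?S 0 n \<omega> < - (real n / real (Suc k))"
        by (auto simp: C_def not_le)
      also have "\<dots> \<le> 0" by simp
      finally show ?case by (auto simp: atLeast0LessThan)
    qed
    then show False using expectation_nonpos_if_sums_go_negative pos by simp
  qed
  then have "prob (C 0) = 1" using prob_tail_event_0_1[OF tail] by blast
  then have "AE \<omega> in M. \<omega> \<in> C 0" using meas by (simp add: prob_eq_1)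
  then show ?thesis by eventually_elim (simp add: C_def atLeast0LessThan)
qed

end

lemma iid_compose:
  fixes X :: "nat \<Rightarrow> 'a \<Rightarrow> real"
  assumes indep: "indep_vars (\<lambda>_. borel) X UNIV"
    and ident: "\<And>i. distr M borel (X i) = distr M borel (X 0)"
    and g [measurable]: "g \<in> borel_measurable borel"
  shows "indep_vars (\<lambda>_. borel) (\<lambda>i \<omega>. g (X i \<omega>) :: real) UNIV"
    and "distr M borel (\<lambda>\<omega>. g (X i \<omega>)) = distr M borel (\<lambda>\<omega>. g (X 0 \<omega>))"
proof -
  show "indep_vars (\<lambda>_. borel) (\<lambda>i \<omega>. g (X i \<omega>)) UNIV"
    by (rule indep_vars_compose2[OF indep]) auto
  have [measurable]: "X i \<in> borel_measurable M" for i
    using indep unfolding indep_vars_def2 by blast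
  have d: "distr M borel (\<lambda>\<omega>. g (X i \<omega>)) = distr (distr M borel (X i)) borel g" for i
    by (simp add: distr_distr comp_def)
  show "distr M borel (\<lambda>\<omega>. g (X i \<omega>)) = distr M borel (\<lambda>\<omega>. g (X 0 \<omega>))"
    by (simp only: d[of i] d[of 0] ident[of i])
qed

lemma strong_law_lower:
  fixes X :: "nat \<Rightarrow> 'a \<Rightarrow> real"
  assumes indep: "indep_vars (\<lambda>_. borel) X UNIV"
    and ident: "\<And>i. distr M borel (X i) = distr M borel (X 0)"
    and int: "integrable M (X 0)" and e: "e > 0"
  shows "AE \<omega> in M. \<forall>\<^sub>F n in sequentially. (\<Sum>i<n. X i \<omega>) / real n \<ge> expectation (X 0) - e"
proof -
  \<comment> \<open>Centring leaves the positive mean \<open>e / 2\<close>; the other half of \<open>e\<close> pays for the error term.\<close>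
  define a where "a = expectation (X 0) - e / 2"
  have "expectation (\<lambda>\<omega>. X 0 \<omega> - a) = e / 2"
    using int by (simp add: a_def prob_space)
  then have "AE \<omega> in M. \<forall>k. \<exists>N. \<forall>n\<ge>N. (\<Sum>i<n. X i \<omega> - a) \<ge> - (real n / real (Suc k))"
    using e by (intro eventually_average_lower_bound_if_expectation_pos iid_compose[OF indep ident]
        Bochner_Integration.integrable_diff int) auto
  then show ?thesis
  proof eventually_elim
    case (elim \<omega>)
    obtain k where k: "inverse (real (Suc k)) < e / 2"
      using reals_Archimedean[of "e / 2"] e half_gt_zero by blast
    obtain N where N: "\<And>n. n \<ge> N \<Longrightarrow> (\<Sum>i<n. X i \<omega> - a) \<ge> - (real n / real (Suc k))"
      using elim by blast
    show ?case
      using eventually_ge_at_top[of "max 1 N"]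
    proof eventually_elim
      case (elim n)
      have "(\<Sum>i<n. X i \<omega>) \<ge> real n * a - real n * inverse (real (Suc k))"
        using N[of n] elim by (simp add: sum_subtractf divide_inverse)
      also have "real n * a - real n * inverse (real (Suc k)) \<ge> real n * a - real n * (e / 2)"
        using k by (intro diff_left_mono mult_left_mono) auto
      finally have "(\<Sum>i<n. X i \<omega>) \<ge> (expectation (X 0) - e) * real n"
        by (simp add: a_def algebra_simps)
      then show ?case using elim by (simp add: pos_le_divide_eq)
    qed
  qed
qed

theorem strong_law_of_large_numbers:
  fixes X :: "nat \<Rightarrow> 'a \<Rightarrow> real"
  assumes indep: "indep_vars (\<lambda>_. borel) X UNIV"
    and ident: "\<And>i. distr M borel (X i) = distr M borel (X 0)"
    and int: "integrable M (X 0)"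
  shows "AE \<omega> in M. (\<lambda>n. (\<Sum>i<n. X i \<omega>) / real n) \<longlonglongrightarrow> expectation (X 0)"
proof -
  let ?a = "\<lambda>n \<omega>. (\<Sum>i<n. X i \<omega>) / real n"
  let ?\<mu> = "expectation (X 0)"
  have "AE \<omega> in M. \<forall>k. \<forall>\<^sub>F n in sequentially. ?a n \<omega> \<ge> ?\<mu> - inverse (real (Suc k))"
    by (intro AE_all_countable[THEN iffD2] allI strong_law_lower[OF indep ident int]) simp
  moreover have "AE \<omega> in M. \<forall>k. \<forall>\<^sub>F n in sequentially. - ?a n \<omega> \<ge> - ?\<mu> - inverse (real (Suc k))"
  proof (intro AE_all_countable[THEN iffD2] allI)
    fix k
    have "AE \<omega> in M. \<forall>\<^sub>F n in sequentially.
        (\<Sum>i<n. - X i \<omega>) / real n \<ge> expectation (\<lambda>\<omega>. - X 0 \<omega>) - inverse (real (Suc k))"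
      by (rule strong_law_lower[OF iid_compose[OF indep ident]]) (simp_all add: int)
    then show "AE \<omega> in M. \<forall>\<^sub>F n in sequentially. - ?a n \<omega> \<ge> - ?\<mu> - inverse (real (Suc k))"
      by (simp add: sum_negf)
  qed
  ultimately show ?thesis
  proof eventually_elim
    case (elim \<omega>)
    show ?case
    proof (rule tendstoI)
      fix e :: real assume "e > 0"
      then obtain k where k: "inverse (real (Suc k)) < e"
        using reals_Archimedean by blast
      from elim(1)[rule_format, of k] elim(2)[rule_format, of k]
      show "\<forall>\<^sub>F n in sequentially. dist (?a n \<omega>) ?\<mu> < e"
      proof eventually_elim
        case (elim n)
        have "\<bar>?a n \<omega> - ?\<mu>\<bar> \<le> inverse (real (Suc k))"
          using elim by (intro abs_leI) linarith+
        with k show ?case unfolding dist_real_def by (rule le_less_trans[rotated])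
      qed
    qed
  qed
qed

end


section \<open>Infima of normal integrands\<close>

lemma measurable_section_cost:
  assumes "(\<lambda>(y, q). c y q) \<in> borel_measurable (D \<Otimes>\<^sub>M borel)"
  shows "(\<lambda>y. c y q :: real) \<in> borel_measurable D"
  using measurable_compose[OF measurable_Pair2'[of q borel D] assms] by simp

text \<open>
  The strict sublevel set at \<open>a\<close> is the projection of the set of pairs with \<open>q \<in> U\<close> and \<open>c y q < a\<close>.
\<close>
lemma measurable_INF_completion:
  fixes c :: "'y \<Rightarrow> 'q::polish_space \<Rightarrow> real"
  assumes D: "finite_measure D" and c: "(\<lambda>(y, q). c y q) \<in> borel_measurable (D \<Otimes>\<^sub>M borel)"
    and U: "U \<in> sets borel"
  shows "(\<lambda>y. INF q\<in>U. ereal (c y q)) \<in> borel_measurable (completion D)"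
proof (rule borel_measurableI_less)
  fix a :: ereal
  note [measurable] = c U
  let ?A = "{p \<in> space (D \<Otimes>\<^sub>M borel). snd p \<in> U \<and> ereal ((\<lambda>(y, q). c y q) p) < a}"
  have "?A \<in> sets (D \<Otimes>\<^sub>M borel)" by measurable
  from measurable_projection[OF D this]
  have "fst ` ?A \<in> sets (completion D)" .
  also have "fst ` ?A = {y \<in> space (completion D). (INF q\<in>U. ereal (c y q)) < a}"
    by (force simp: INF_less_iff space_pair_measure image_iff)
  finally show "{y \<in> space (completion D). (INF q\<in>U. ereal (c y q)) < a} \<in> sets (completion D)" .
qed

text \<open>
  Composing with the samples requires measurability with respect to the original sigma-algebra, so the
  infimum is replaced by a version of it that has this property. It is finite almost everywhere, being squeezed between
  \<open>h\<close> and the cost at the point \<open>u\<close>.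
\<close>
lemma real_version_of_INF:
  fixes c :: "'y \<Rightarrow> 'q::polish_space \<Rightarrow> real"
  assumes D: "finite_measure D" and c: "(\<lambda>(y, q). c y q) \<in> borel_measurable (D \<Otimes>\<^sub>M borel)"
    and U: "U \<in> sets borel" "u \<in> U"
    and h: "integrable D h" "AE y in D. \<forall>q. h y \<le> c y q"
    and u: "integrable D (\<lambda>y. c y u)"
  obtains G where "integrable D G" "AE y in D. (INF q\<in>U. ereal (c y q)) = ereal (G y)"
    "AE y in D. \<bar>G y\<bar> \<le> \<bar>h y\<bar> + \<bar>c y u\<bar>"
proof -
  let ?H = "\<lambda>y. INF q\<in>U. ereal (c y q)"
  have "(\<lambda>y. real_of_ereal (?H y)) \<in> borel_measurable (completion D)"
    using measurable_INF_completion[OF D c U(1)] by simp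
  then obtain G where G: "G \<in> borel_measurable D" "AE y in D. real_of_ereal (?H y) = G y"
    using completion_ex_borel_measurable_real by blast
  have *: "AE y in D. ?H y = ereal (G y) \<and> \<bar>G y\<bar> \<le> \<bar>h y\<bar> + \<bar>c y u\<bar>"
    using h(2) G(2)
  proof eventually_elim
    case (elim y)
    have "ereal (h y) \<le> ?H y" using elim(1) by (intro INF_greatest) simp
    moreover have "?H y \<le> ereal (c y u)" using U(2) by (rule INF_lower)
    ultimately have "?H y = ereal (G y)" "h y \<le> G y" "G y \<le> c y u"
      using elim(2) by (cases "?H y"; force)+
    then show ?case by auto
  qed
  have "integrable D G"
  proof (rule Bochner_Integration.integrable_bound)
    show "integrable D (\<lambda>y. \<bar>h y\<bar> + \<bar>c y u\<bar>)" using h u by auto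
    show "AE y in D. norm (G y) \<le> norm (\<bar>h y\<bar> + \<bar>c y u\<bar>)"
      using * by eventually_elim auto
  qed (rule G(1))
  then show thesis using * by (intro that[of G]) (auto elim: eventually_mono)
qed

text \<open>
  Lower semicontinuity bounds \<open>f\<close> below near the centre but not at it; the value at the centre itself
  handles that point and also bounds the infima above.
\<close>
lemma INF_ball_tendsto_lower_semicont:
  fixes f :: "'q::metric_space \<Rightarrow> real"
  assumes "lower_semicont f"
  shows "(\<lambda>n. INF q\<in>ball x (1 / real (Suc n)). ereal (f q)) \<longlonglongrightarrow> ereal (f x)"
proof (rule order_tendstoI)
  fix a assume "a < ereal (f x)"
  then obtain b where b: "a < b" "b < ereal (f x)" using dense by blast
  have "\<forall>\<^sub>F q in at x. b < ereal (f q)"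
    using assms b(2) unfolding lower_semicont_def le_Liminf_iff by blast
  then obtain d where d: "d > 0" "\<And>q. q \<noteq> x \<Longrightarrow> dist q x < d \<Longrightarrow> b < ereal (f q)"
    unfolding eventually_at by auto
  obtain N where N: "inverse (real (Suc N)) < d" using reals_Archimedean d(1) by blast
  show "\<forall>\<^sub>F n in sequentially. a < (INF q\<in>ball x (1 / real (Suc n)). ereal (f q))"
    using eventually_ge_at_top[of N]
  proof eventually_elim
    case (elim n)
    have "1 / real (Suc n) \<le> 1 / real (Suc N)"
      using elim by (intro divide_left_mono) auto
    then have "1 / real (Suc n) < d" using N by (simp add: inverse_eq_divide)
    then have "b \<le> ereal (f q)" if "q \<in> ball x (1 / real (Suc n))" for q
      using that d(2)[of q] b(2) by (cases "q = x") (auto simp: dist_commute intro: less_imp_le)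
    then have "b \<le> (INF q\<in>ball x (1 / real (Suc n)). ereal (f q))" by (intro INF_greatest)
    with b(1) show ?case by simp
  qed
next
  fix a assume a: "ereal (f x) < a"
  have "(INF q\<in>ball x (1 / real (Suc n)). ereal (f q)) \<le> ereal (f x)" for n
    by (rule INF_lower) simp
  then show "\<forall>\<^sub>F n in sequentially. (INF q\<in>ball x (1 / real (Suc n)). ereal (f q)) < a"
    using a by (intro always_eventually) (auto intro: le_less_trans)
qed

text \<open>
  Dominated convergence for the infima over balls of radius \<open>1 / (n + 1)\<close> around \<open>x\<close>, with dominating
  function \<open>\<bar>h\<bar> + \<bar>c \<cdot> x\<bar>\<close>.
\<close>
lemma ball_minorant_with_large_integral:
  fixes c :: "'y \<Rightarrow> 'q::polish_space \<Rightarrow> real"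
  assumes D: "finite_measure D" and c: "(\<lambda>(y, q). c y q) \<in> borel_measurable (D \<Otimes>\<^sub>M borel)"
    and lsc: "\<And>y. y \<in> space D \<Longrightarrow> lower_semicont (c y)"
    and h: "integrable D h" "AE y in D. \<forall>q. h y \<le> c y q"
    and int: "integrable D (\<lambda>y. c y x)"
    and a: "a < (\<integral>y. c y x \<partial>D)"
  obtains r G where "r > 0" "integrable D G" "AE y in D. \<forall>q\<in>ball x r. G y \<le> c y q"
    "a < (\<integral>y. G y \<partial>D)"
proof -
  let ?B = "\<lambda>n. ball x (1 / real (Suc n))"
  define V where "V n G \<longleftrightarrow> integrable D G \<and> (AE y in D. (INF q\<in>?B n. ereal (c y q)) = ereal (G y)) \<and>
      (AE y in D. \<bar>G y\<bar> \<le> \<bar>h y\<bar> + \<bar>c y x\<bar>)" for n G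
  have "\<exists>G. V n G" for n
    unfolding V_def by (rule real_version_of_INF[OF D c _ _ h int, of "?B n"]) auto
  then obtain G where V: "\<And>n. V n (G n)" by metis
  have G: "integrable D (G n)" "AE y in D. (INF q\<in>?B n. ereal (c y q)) = ereal (G n y)"
    "AE y in D. \<bar>G n y\<bar> \<le> \<bar>h y\<bar> + \<bar>c y x\<bar>" for n
    using V[of n] unfolding V_def by blast+
  have "(\<lambda>n. \<integral>y. G n y \<partial>D) \<longlonglongrightarrow> (\<integral>y. c y x \<partial>D)"
  proof (rule integral_dominated_convergence[where w = "\<lambda>y. \<bar>h y\<bar> + \<bar>c y x\<bar>"])
    have "AE y in D. \<forall>n. (INF q\<in>?B n. ereal (c y q)) = ereal (G n y)"
      using G(2) by (simp add: AE_all_countable)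
    with AE_space show "AE y in D. (\<lambda>n. G n y) \<longlonglongrightarrow> c y x"
    proof eventually_elim
      case (elim y)
      then show ?case using INF_ball_tendsto_lower_semicont[OF lsc, of y x] by simp
    qed
  qed (use G h int in auto)
  then have "\<forall>\<^sub>F n in sequentially. a < (\<integral>y. G n y \<partial>D)"
    using a by (rule order_tendstoD)
  then obtain n where n: "a < (\<integral>y. G n y \<partial>D)"
    by (auto dest: eventually_happens)
  have "AE y in D. \<forall>q\<in>?B n. G n y \<le> c y q"
    using G(2)[of n]
  proof eventually_elim
    case (elim y)
    show ?case
    proof
      fix q assume "q \<in> ?B n"
      then have "ereal (G n y) \<le> ereal (c y q)" unfolding elim[symmetric] by (rule INF_lower)
      then show "G n y \<le> c y q" by simp
    qed
  qed
  then show thesis using n G(1) by (intro that[of "1 / real (Suc n)" "G n"]) auto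
qed

text \<open>
  The positive part of the infimum has finite expectation because \<open>c (Y \<omega>) q\<^sub>0\<close> does; hence an expectation
  above \<open>-\<infinity>\<close> means that the negative part has finite expectation. The negative of a measurable version of
  that part is the minorant.
\<close>
lemma integrable_minorant:
  fixes c :: "'y \<Rightarrow> 'q::polish_space \<Rightarrow> real"
  assumes P: "prob_space P" and Y: "Y \<in> measurable P MY"
    and c: "(\<lambda>(y, q). c y q) \<in> borel_measurable (MY \<Otimes>\<^sub>M borel)"
    and int: "integrable P (\<lambda>\<omega>. c (Y \<omega>) q\<^sub>0)"
    and inf: "ereal_expectation (completion P) (\<lambda>\<omega>. INF q. ereal (c (Y \<omega>) q)) > - \<infinity>"
  obtains h where "integrable (distr P MY Y) h" "AE y in distr P MY Y. \<forall>q. h y \<le> c y q"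
proof -
  interpret prob_space P by fact
  note [measurable] = Y
  define D where "D = distr P MY Y"
  interpret D: prob_space D unfolding D_def using Y by (rule prob_space_distr)
  have cD: "(\<lambda>(y, q). c y q) \<in> borel_measurable (D \<Otimes>\<^sub>M borel)"
    using c by (simp add: D_def cong: measurable_cong_sets sets_pair_measure_cong)
  let ?H = "\<lambda>y. INF q. ereal (c y q)"
  have H: "?H \<in> borel_measurable (completion D)"
    by (rule measurable_INF_completion[OF D.finite_measure_axioms cD]) simp
  have "(\<integral>\<^sup>+\<omega>. e2ennreal (?H (Y \<omega>)) \<partial>completion P) \<le> (\<integral>\<^sup>+\<omega>. ennreal \<bar>c (Y \<omega>) q\<^sub>0\<bar> \<partial>P)"
    unfolding nn_integral_completion
  proof (rule nn_integral_mono)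
    fix \<omega>
    have "?H (Y \<omega>) \<le> ereal (c (Y \<omega>) q\<^sub>0)" by (rule INF_lower) simp
    also have "\<dots> \<le> ereal \<bar>c (Y \<omega>) q\<^sub>0\<bar>" by simp
    finally have "e2ennreal (?H (Y \<omega>)) \<le> e2ennreal (ereal \<bar>c (Y \<omega>) q\<^sub>0\<bar>)" by (rule e2ennreal_mono)
    then show "e2ennreal (?H (Y \<omega>)) \<le> ennreal \<bar>c (Y \<omega>) q\<^sub>0\<bar>" by simp
  qed
  also have "\<dots> < \<infinity>" using int by (simp add: integrable_iff_bounded)
  finally have pos: "(\<integral>\<^sup>+\<omega>. e2ennreal (?H (Y \<omega>)) \<partial>completion P) < \<infinity>" .
  have neg: "(\<integral>\<^sup>+\<omega>. e2ennreal (- ?H (Y \<omega>)) \<partial>completion P) \<noteq> \<infinity>"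
  proof
    assume "(\<integral>\<^sup>+\<omega>. e2ennreal (- ?H (Y \<omega>)) \<partial>completion P) = \<infinity>"
    then show False
      using inf pos unfolding ereal_expectation_def
      by (cases "\<integral>\<^sup>+\<omega>. e2ennreal (?H (Y \<omega>)) \<partial>completion P") (auto simp: enn2ereal_ennreal)
  qed
  have "(\<lambda>y. e2ennreal (- ?H y)) \<in> borel_measurable (completion D)" using H by measurable
  then obtain g where g [measurable]: "g \<in> borel_measurable D" and gH: "AE y in D. e2ennreal (- ?H y) = g y"
    using completion_ex_borel_measurable by blast
  have g' [measurable]: "g \<in> borel_measurable MY" using g by (simp add: D_def)
  have "AE \<omega> in P. e2ennreal (- ?H (Y \<omega>)) = g (Y \<omega>)"
    using gH unfolding D_def by (rule AE_distrD[OF Y])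
  then have "(\<integral>\<^sup>+\<omega>. e2ennreal (- ?H (Y \<omega>)) \<partial>completion P) = (\<integral>\<^sup>+\<omega>. g (Y \<omega>) \<partial>P)"
    unfolding nn_integral_completion by (rule nn_integral_cong_AE)
  also have "\<dots> = (\<integral>\<^sup>+y. g y \<partial>D)"
    unfolding D_def by (subst nn_integral_distr) auto
  finally have fin: "(\<integral>\<^sup>+y. g y \<partial>D) \<noteq> \<infinity>" using neg by simp
  then have g_fin: "AE y in D. g y \<noteq> \<infinity>" by (intro nn_integral_PInf_AE) auto
  show thesis
  proof (rule that[of "\<lambda>y. - enn2real (g y)"], fold D_def)
    have "integrable D (\<lambda>y. enn2real (g y))"
    proof (rule integrableI_bounded)
      have "(\<integral>\<^sup>+y. ennreal (norm (enn2real (g y))) \<partial>D) \<le> (\<integral>\<^sup>+y. g y \<partial>D)"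
        by (intro nn_integral_mono) (simp add: ennreal_enn2real_if)
      also have "\<dots> < \<infinity>" using fin by (simp add: less_top)
      finally show "(\<integral>\<^sup>+y. ennreal (norm (enn2real (g y))) \<partial>D) < \<infinity>" .
    qed simp
    then show "integrable D (\<lambda>y. - enn2real (g y))" by simp
    show "AE y in D. \<forall>q. - enn2real (g y) \<le> c y q"
      using gH g_fin
    proof (eventually_elim, intro allI)
      fix y q assume y: "e2ennreal (- ?H y) = g y" "g y \<noteq> \<infinity>"
      have "ereal (- c y q) \<le> - ?H y"
        using INF_lower[of q UNIV "\<lambda>q. ereal (c y q)"] by (simp flip: uminus_ereal.simps)
      then have "ennreal (- c y q) \<le> g y"
        unfolding y(1)[symmetric] by (metis e2ennreal_ereal e2ennreal_mono)
      then show "- enn2real (g y) \<le> c y q"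
        using y(2) by (cases "g y") (auto simp: ennreal_le_iff2)
    qed
  qed
qed

section \<open>Near minimisers and the outer limit\<close>

lemma eps_argmin_disjoint:
  assumes "\<And>q. q \<in> U \<Longrightarrow> g \<le> f q" and "f p + e < g"
  shows "U \<inter> eps_argmin_set e f = {}"
proof -
  have "\<not> ereal (f q) \<le> ereal e + (INF q'. ereal (f q'))" if "q \<in> U" for q
  proof -
    have "ereal e + (INF q'. ereal (f q')) \<le> ereal e + ereal (f p)"
      by (intro add_left_mono INF_lower) simp
    also have "\<dots> < ereal (f q)" using assms(1)[OF that] assms(2) by simp
    finally show ?thesis by simp
  qed
  then show ?thesis by (auto simp: eps_argmin_set_def)
qed

lemma disjoint_outer_limit:
  assumes "open U" and "\<forall>\<^sub>F n in sequentially. U \<inter> B n = {}"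
  shows "U \<inter> outer_limit B = {}"
proof -
  obtain N where "\<And>n. n \<ge> N \<Longrightarrow> U \<inter> B n = {}"
    using assms(2) by (auto simp: eventually_sequentially)
  then have "U \<inter> (\<Union>k\<in>{N..}. B k) = {}" by auto
  then have "U \<inter> closure (\<Union>k\<in>{N..}. B k) = {}"
    using assms(1) by (simp add: open_Int_closure_eq_empty)
  then show ?thesis by (auto simp: outer_limit_def)
qed

lemma strong_law_of_large_numbers_compose:
  fixes g :: "'y \<Rightarrow> real"
  assumes P: "prob_space P"
    and indep: "prob_space.indep_vars P (\<lambda>_. MY) Yi {1..}"
    and ident: "\<And>i. i \<ge> 1 \<Longrightarrow> distr P MY (Yi i) = D"
    and g: "integrable D g"
  shows "AE \<omega> in P. (\<lambda>n. (1 / real n) * (\<Sum>i=1..n. g (Yi i \<omega>))) \<longlonglongrightarrow> (\<integral>y. g y \<partial>D)"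
proof -
  interpret prob_space P by fact
  have Yi [measurable]: "Yi (Suc i) \<in> measurable P MY" for i
    using indep unfolding indep_vars_def2 by simp
  have sets_D: "sets D = sets MY" using ident[of 1] by auto
  have gm [measurable]: "g \<in> borel_measurable MY"
    using borel_measurable_integrable[OF g] by (simp cong: measurable_cong_sets add: sets_D)
  have "range Suc = {1..}" by (auto simp: image_iff) (metis Suc_le_D)
  with indep have "indep_vars (\<lambda>_. MY) Yi (range Suc)" by simp
  then have "indep_vars (\<lambda>_. MY) (\<lambda>i. Yi (Suc i)) UNIV" by (rule indep_vars_reindex) simp
  then have 1: "indep_vars (\<lambda>_. borel) (\<lambda>i \<omega>. g (Yi (Suc i) \<omega>)) UNIV"
    by (rule indep_vars_compose2) simp
  have d: "distr P borel (\<lambda>\<omega>. g (Yi (Suc i) \<omega>)) = distr D borel g" for i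
    by (simp add: ident[of "Suc i", symmetric] distr_distr comp_def)
  have "AE \<omega> in P. (\<lambda>n. (\<Sum>i<n. g (Yi (Suc i) \<omega>)) / real n) \<longlonglongrightarrow> expectation (\<lambda>\<omega>. g (Yi (Suc 0) \<omega>))"
  proof (rule strong_law_of_large_numbers[OF 1])
    show "integrable P (\<lambda>\<omega>. g (Yi (Suc 0) \<omega>))"
      using g unfolding ident[of "Suc 0", simplified, symmetric] by (simp add: integrable_distr_eq)
  qed (simp only: d)
  moreover have "expectation (\<lambda>\<omega>. g (Yi (Suc 0) \<omega>)) = (\<integral>y. g y \<partial>D)"
    unfolding ident[of "Suc 0", simplified, symmetric] by (simp add: integral_distr)
  ultimately show ?thesis by (simp add: sum.atLeast1_atMost_eq)
qed

theorem theorem3p2: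
  fixes P :: "'w measure"
    and MY :: "'y measure"
    and c :: "'y \<Rightarrow> 'q::polish_space \<Rightarrow> real"
    and Y :: "'w \<Rightarrow> 'y"
    and Yi :: "nat \<Rightarrow> 'w \<Rightarrow> 'y"
    and \<epsilon> :: "nat \<Rightarrow> real"
  assumes prob: "prob_space P"
    and c_measurable: "(\<lambda>(y, q). c y q) \<in> borel_measurable (MY \<Otimes>\<^sub>M borel)"
    and Y_measurable: "Y \<in> measurable P MY"
    and Yi_indep: "prob_space.indep_vars P (\<lambda>_. MY) Yi {1..}"
    and Yi_distr: "\<And>i. i \<ge> 1 \<Longrightarrow> distr P MY (Yi i) = distr P MY Y"
    and eps_nonneg: "\<And>n. n \<ge> 1 \<Longrightarrow> 0 \<le> \<epsilon> n"
    and eps_tendsto: "\<epsilon> \<longlonglongrightarrow> 0"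
    and c_lsc: "\<And>y. y \<in> space MY \<Longrightarrow> lower_semicont (c y)"
    and c_integrable: "\<And>q. integrable P (\<lambda>\<omega>. c (Y \<omega>) q)"
    and inf_expectation:
      "ereal_expectation (completion P) (\<lambda>\<omega>. INF q. ereal (c (Y \<omega>) q)) > - \<infinity>"
  shows "AE \<omega> in P.
    outer_limit (\<lambda>n. eps_argmin_set (\<epsilon> n) (\<lambda>q. (1 / real n) * (\<Sum>i=1..n. c (Yi i \<omega>) q)))
      \<subseteq> argmin_set (\<lambda>q. \<integral>\<omega>'. c (Y \<omega>') q \<partial>P)"
proof -
  interpret prob_space P by fact
  define D where "D = distr P MY Y"
  interpret D: prob_space D unfolding D_def using Y_measurable by (rule prob_space_distr)
  have cD: "(\<lambda>(y, q). c y q) \<in> borel_measurable (D \<Otimes>\<^sub>M borel)"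
    using c_measurable by (simp add: D_def cong: measurable_cong_sets sets_pair_measure_cong)
  have c_meas [measurable]: "(\<lambda>y. c y q) \<in> borel_measurable MY" for q
    by (rule measurable_section_cost[OF c_measurable])
  have c_int: "integrable D (\<lambda>y. c y q)" for q
    using c_integrable[of q] Y_measurable by (simp add: D_def integrable_distr_eq)
  define F where "F q = (\<integral>\<omega>. c (Y \<omega>) q \<partial>P)" for q
  have F_eq: "F q = (\<integral>y. c y q \<partial>D)" for q
    using Y_measurable by (simp add: F_def D_def integral_distr)
  define Fn where "Fn n \<omega> q = (1 / real n) * (\<Sum>i=1..n. c (Yi i \<omega>) q)" for n \<omega> q
  obtain h where h: "integrable D h" "AE y in D. \<forall>q. h y \<le> c y q"
    using integrable_minorant[OF prob Y_measurable c_measurable c_integrable inf_expectation]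
    unfolding D_def by blast
  have Yi_D: "distr P MY (Yi i) = D" if "i \<ge> 1" for i
    using Yi_distr[OF that] by (simp add: D_def)
  have Yi_meas: "Yi i \<in> measurable P MY" if "i \<ge> 1" for i
    using Yi_indep that unfolding indep_vars_def2 by simp
  \<comment> \<open>On a good set the empirical means stay above the value at \<open>p\<close>; every point that is not a minimiser has a good neighbourhood in a countable base.\<close>
  define good where "good U \<longleftrightarrow> (\<exists>G p. integrable D G \<and> (AE y in D. \<forall>q\<in>U. G y \<le> c y q) \<and>
      F p < (\<integral>y. G y \<partial>D))" for U
  have avoid: "AE \<omega> in P. U \<inter> outer_limit (\<lambda>n. eps_argmin_set (\<epsilon> n) (Fn n \<omega>)) = {}"
    if "open U" "good U" for U
  proof -
    obtain G p where G: "integrable D G" "AE y in D. \<forall>q\<in>U. G y \<le> c y q" "F p < (\<integral>y. G y \<partial>D)"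
      using \<open>good U\<close> unfolding good_def by blast
    have "AE \<omega> in P. \<forall>i. i \<ge> 1 \<longrightarrow> (\<forall>q\<in>U. G (Yi i \<omega>) \<le> c (Yi i \<omega>) q)"
      unfolding AE_all_countable
    proof
      fix i
      show "AE \<omega> in P. i \<ge> 1 \<longrightarrow> (\<forall>q\<in>U. G (Yi i \<omega>) \<le> c (Yi i \<omega>) q)"
      proof (cases "i \<ge> 1")
        case True
        then have "AE \<omega> in P. \<forall>q\<in>U. G (Yi i \<omega>) \<le> c (Yi i \<omega>) q"
          using AE_distrD[OF Yi_meas[OF True], of "\<lambda>y. \<forall>q\<in>U. G y \<le> c y q"] G(2)
          by (simp only: Yi_D[OF True])
        then show ?thesis by eventually_elim simp
      qed simp
    qed
    moreover have "AE \<omega> in P. (\<lambda>n. (1 / real n) * (\<Sum>i=1..n. G (Yi i \<omega>))) \<longlonglongrightarrow> (\<integral>y. G y \<partial>D)"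
      by (rule strong_law_of_large_numbers_compose[OF prob Yi_indep _ G(1)]) (rule Yi_D)
    moreover have "AE \<omega> in P. (\<lambda>n. Fn n \<omega> p) \<longlonglongrightarrow> F p"
      unfolding Fn_def F_eq
      by (rule strong_law_of_large_numbers_compose[OF prob Yi_indep _ c_int]) (rule Yi_D)
    ultimately show ?thesis
    proof eventually_elim
      case (elim \<omega>)
      note minorant = elim(1)
      have "(\<lambda>n. Fn n \<omega> p + \<epsilon> n) \<longlonglongrightarrow> F p + 0"
        by (intro tendsto_add elim eps_tendsto)
      then have "(\<lambda>n. (1 / real n) * (\<Sum>i=1..n. G (Yi i \<omega>)) - (Fn n \<omega> p + \<epsilon> n)) \<longlonglongrightarrow> (\<integral>y. G y \<partial>D) - (F p + 0)"
        by (intro tendsto_diff elim)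
      then have "\<forall>\<^sub>F n in sequentially. 0 < (1 / real n) * (\<Sum>i=1..n. G (Yi i \<omega>)) - (Fn n \<omega> p + \<epsilon> n)"
        by (rule order_tendstoD(1)) (use G(3) in simp)
      then have "\<forall>\<^sub>F n in sequentially. Fn n \<omega> p + \<epsilon> n < (1 / real n) * (\<Sum>i=1..n. G (Yi i \<omega>))"
        by (simp only: diff_gt_0_iff_gt)
      then have "\<forall>\<^sub>F n in sequentially. U \<inter> eps_argmin_set (\<epsilon> n) (Fn n \<omega>) = {}"
      proof eventually_elim
        case (elim n)
        show ?case
        proof (rule eps_argmin_disjoint)
          show "Fn n \<omega> p + \<epsilon> n < (1 / real n) * (\<Sum>i=1..n. G (Yi i \<omega>))" by (rule elim)
          fix q assume "q \<in> U"
          then show "(1 / real n) * (\<Sum>i=1..n. G (Yi i \<omega>)) \<le> Fn n \<omega> q"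
            unfolding Fn_def using minorant by (intro mult_left_mono sum_mono) auto
        qed
      qed
      then show ?case by (rule disjoint_outer_limit[OF \<open>open U\<close>])
    qed
  qed
  obtain \<B> :: "'q set set" where \<B>: "countable \<B>" "topological_basis \<B>"
    using ex_countable_basis by blast
  have "AE \<omega> in P. \<forall>U\<in>{U\<in>\<B>. good U}. U \<inter> outer_limit (\<lambda>n. eps_argmin_set (\<epsilon> n) (Fn n \<omega>)) = {}"
    using \<B> avoid by (subst AE_ball_countable) (auto intro: topological_basis_open)
  then show ?thesis
    unfolding F_def[symmetric] Fn_def[symmetric]
  proof eventually_elim
    case (elim \<omega>)
    show ?case
    proof
      fix x assume x: "x \<in> outer_limit (\<lambda>n. eps_argmin_set (\<epsilon> n) (Fn n \<omega>))"
      show "x \<in> argmin_set F"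
      proof (rule ccontr)
        assume "x \<notin> argmin_set F"
        then have "(INF q. ereal (F q)) \<noteq> ereal (F x)" by (auto simp: argmin_set_def)
        moreover have "(INF q. ereal (F q)) \<le> ereal (F x)" by (rule INF_lower) simp
        ultimately have "(INF q. ereal (F q)) < ereal (F x)" by simp
        then obtain p where "F p < F x" by (auto simp: INF_less_iff)
        then have p: "F p < (\<integral>y. c y x \<partial>D)" by (simp add: F_eq)
        have lsc: "lower_semicont (c y)" if "y \<in> space D" for y
          using c_lsc that by (simp add: D_def)
        obtain r G where G: "r > 0" "integrable D G" "AE y in D. \<forall>q\<in>ball x r. G y \<le> c y q"
          "F p < (\<integral>y. G y \<partial>D)"
          by (rule ball_minorant_with_large_integral[OF D.finite_measure_axioms cD _ h c_int p])
            (erule lsc, rule that)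
        obtain U where U: "U \<in> \<B>" "x \<in> U" "U \<subseteq> ball x r"
          using topological_basisE[OF \<B>(2) open_ball, of x x r] G(1) by auto
        have "good U"
          unfolding good_def using G(2,4) U(3)
          by (intro exI[of _ G] exI[of _ p] conjI) (auto intro: eventually_mono[OF G(3)])
        with elim U x show False by blast
      qed
    qed
  qed
qed

end
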